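(* Let $p\ge1$. The set $\widehat{\mathscr S_{\mathrm{inv}}}(2p+2)$ of isomorphism classes of invertible singular quadratic Lie algebra structures on $\mathbb C^{2p+2}$ is in bijection with $\mathcal J_p/\mathbb C^*$.
   Context: All vector spaces are finite-dimensional over $\mathbb C$; $\mathbb C^*=\mathbb C\setminus\{0\}$ and $\mathbb N^*$ is the set of positive integers. A quadratic Lie algebra $(\mathfrak g,B)$ is a Lie algebra with a non-degenerate symmetric invariant bilinear form. Let $I(X,Y,Z)=B([X,Y],Z)$ and $\mathrm{dup}(\mathfrak g)=\dim\{\alpha\in\mathfrak g^*\mid\alpha\wedge I=0\}$; a non-Abelian quadratic Lie algebra is singular if $\mathrm{dup}(\mathfrak g)\ge1$. A quadratic Lie algebra structure on $\mathbb C^{2p+2}$ is a Lie bracket for which the canonical non-degenerate symmetric bilinear form is invariant. Every solvable singular quadratic Lie algebra is a double extension: it has an orthogonal decomposition $\mathfrak g=(\mathbb CX_0\oplus\mathbb CY_0)\oplus\mathfrak q$ with $B(X_0,X_0)=B(Y_0,Y_0)=0$, $B(X_0,Y_0)=1$, and bracket $[X+\lambda X_0+\mu Y_0,\,Y+\lambda'X_0+\mu'Y_0]=\mu\overline C(Y)-\mu'\overline C(X)+B(\overline C(X),Y)X_0$ ($X,Y\in\mathfrak q$), with $\overline C=\mathrm{ad}(Y_0)|_{\mathfrak q}$ skew-symmetric. It is called invertible if $\overline C$ is invertible (independent of the decomposition). For invertible ones, isomorphism classes and isometric-isomorphism classes coincide. Let $\mathcal D=\bigcup_{r\in\mathbb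 N^*}\{(d_1,\dots,d_r)\in\mathbb N^r\mid d_1\ge\dots\ge d_r\ge1\}$ and $\Phi(d_1,\dots,d_r)=\sum_{i=1}^r d_i$. $\mathcal J_p$ is the set of triples $(\Lambda,m,d)$ such that: (1) $\Lambda\subset\mathbb C\setminus\{0\}$ has at most $2p$ elements and $\lambda\in\Lambda\iff-\lambda\in\Lambda$; (2) $m:\Lambda\to\mathbb N^*$ satisfies $m(\lambda)=m(-\lambda)$ for all $\lambda\in\Lambda$ and $\sum_{\lambda\in\Lambda}m(\lambda)=2p$; (3) $d:\Lambda\to\mathcal D$ satisfies $d(\lambda)=d(-\lambda)$ for all $\lambda\in\Lambda$ and $\Phi\circ d=m$. The group $\mathbb C^*$ acts on $\mathcal J_p$ by $\mu\cdot(\Lambda,m,d)=(\mu\Lambda,m',d')$ with $m'(\mu\lambda)=m(\lambda)$, $d'(\mu\lambda)=d(\lambda)$ for $\lambda\in\Lambda$, and $\mathcal J_p/\mathbb C^*$ is the set of orbits. *)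

theory Defs
  imports "HOL-Analysis.Analysis" "HOL-Library.Function_Algebras"
begin

section \<open>Quadratic Lie algebra structures on \<open>\<complex>\<^sup>n\<close>\<close>

text \<open>
  The underlying space is \<^typ>\<open>complex^'n\<close>, with its complex vector space structure \<^term>\<open>(*s)\<close>;
  its dimension is \<^term>\<open>CARD('n)\<close>. The canonical non-degenerate symmetric bilinear form is
  \<^const>\<open>scalar_product\<close>, which is complex bilinear (no conjugation).
\<close>

type_synonym 'n bracket = "complex^'n \<Rightarrow> complex^'n \<Rightarrow> complex^'n"

definition lie_bracket :: "'n::finite bracket \<Rightarrow> bool" where
  "lie_bracket br \<longleftrightarrow>
     (\<forall>X. Vector_Spaces.linear (*s) (*s) (br X)) \<and>
     (\<forall>Y. Vector_Spaces.linear (*s) (*s) (\<lambda>X. br X Y)) \<and>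
     (\<forall>X. br X X = 0) \<and>
     (\<forall>X Y Z. br X (br Y Z) + br Y (br Z X) + br Z (br X Y) = 0)"

definition quadratic_structure :: "'n::finite bracket \<Rightarrow> bool" where
  "quadratic_structure br \<longleftrightarrow> lie_bracket br \<and>
     (\<forall>X Y Z. scalar_product (br X Y) Z = scalar_product X (br Y Z))"

definition abelian_bracket :: "'n::finite bracket \<Rightarrow> bool" where
  "abelian_bracket br \<longleftrightarrow> (\<forall>X Y. br X Y = 0)"

definition three_form :: "'n::finite bracket \<Rightarrow> complex^'n \<Rightarrow> complex^'n \<Rightarrow> complex^'n \<Rightarrow> complex" where
  "three_form br X Y Z = scalar_product (br X Y) Z"

text \<open>Exterior product of a linear form with an alternating 3-form, as a 4-linear function.\<close>

definition wedge_1_3 ::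
  "('v \<Rightarrow> complex) \<Rightarrow> ('v \<Rightarrow> 'v \<Rightarrow> 'v \<Rightarrow> complex) \<Rightarrow> 'v \<Rightarrow> 'v \<Rightarrow> 'v \<Rightarrow> 'v \<Rightarrow> complex" where
  "wedge_1_3 \<alpha> J X Y Z W =
     \<alpha> X * J Y Z W - \<alpha> Y * J X Z W + \<alpha> Z * J X Y W - \<alpha> W * J X Y Z"

text \<open>The dimension is taken in the complex vector space of functions \<open>\<complex>\<^sup>n \<rightarrow> \<complex>\<close> (pointwise
  operations), of which the dual space of \<open>\<complex>\<^sup>n\<close> is a subspace.\<close>

definition dup :: "'n::finite bracket \<Rightarrow> nat" where
  "dup br = vector_space.dim (\<lambda>(c::complex) (\<alpha> :: complex^'n \<Rightarrow> complex). (\<lambda>X. c * \<alpha> X))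
     {\<alpha>. Vector_Spaces.linear (*s) (*) \<alpha> \<and>
         (\<forall>X Y Z W. wedge_1_3 \<alpha> (three_form br) X Y Z W = 0)}"

definition singular :: "'n::finite bracket \<Rightarrow> bool" where
  "singular br \<longleftrightarrow> quadratic_structure br \<and> \<not> abelian_bracket br \<and> dup br \<ge> 1"

fun derived_ideal :: "'n::finite bracket \<Rightarrow> nat \<Rightarrow> (complex^'n) set" where
  "derived_ideal br 0 = UNIV"
| "derived_ideal br (Suc k) =
     vec.span {br X Y | X Y. X \<in> derived_ideal br k \<and> Y \<in> derived_ideal br k}"

definition solvable_bracket :: "'n::finite bracket \<Rightarrow> bool" where
  "solvable_bracket br \<longleftrightarrow> (\<exists>k. derived_ideal br k = {0})"


section \<open>Double extensions and invertibility\<close>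

text \<open>
  \<open>double_extension br X0 Y0 q\<close>: the quadratic Lie algebra is the orthogonal sum of the
  hyperbolic plane spanned by \<open>X0\<close>, \<open>Y0\<close> and of \<open>q\<close>, with the double extension bracket given by
  the skew-symmetric endomorphism \<open>br Y0 = ad(Y0)\<close> of \<open>q\<close>. The sum is automatically direct,
  by the values of the form on \<open>X0\<close>, \<open>Y0\<close>.
\<close>

definition double_extension ::
  "'n::finite bracket \<Rightarrow> complex^'n \<Rightarrow> complex^'n \<Rightarrow> (complex^'n) set \<Rightarrow> bool" where
  "double_extension br X0 Y0 q \<longleftrightarrow>
     scalar_product X0 X0 = 0 \<and> scalar_product Y0 Y0 = 0 \<and> scalar_product X0 Y0 = 1 \<and>
     vec.subspace q \<and>
     (\<forall>X\<in>q. scalar_product X0 X = 0 \<and> scalar_product Y0 X = 0) \<and>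
     (\<forall>Z. \<exists>X\<in>q. \<exists>a b. Z = X + a *s X0 + b *s Y0) \<and>
     (\<forall>X\<in>q. br Y0 X \<in> q) \<and>
     (\<forall>X\<in>q. \<forall>Y\<in>q. scalar_product (br Y0 X) Y = - scalar_product X (br Y0 Y)) \<and>
     (\<forall>X\<in>q. \<forall>Y\<in>q. \<forall>a b a' b'.
        br (X + a *s X0 + b *s Y0) (Y + a' *s X0 + b' *s Y0) =
          b *s br Y0 Y - b' *s br Y0 X + scalar_product (br Y0 X) Y *s X0)"

definition invertible_singular :: "'n::finite bracket \<Rightarrow> bool" where
  "invertible_singular br \<longleftrightarrow> singular br \<and> solvable_bracket br \<and>
     (\<exists>X0 Y0 q. double_extension br X0 Y0 q \<and> bij_betw (br Y0) q q)"

definition isomorphic_brackets :: "'n::finite bracket \<Rightarrow> 'n bracket \<Rightarrow> bool" where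
  "isomorphic_brackets br br' \<longleftrightarrow>
     (\<exists>\<phi>. Vector_Spaces.linear (*s) (*s) \<phi> \<and> bij \<phi> \<and> (\<forall>X Y. \<phi> (br X Y) = br' (\<phi> X) (\<phi> Y)))"

definition S_inv :: "'n::finite bracket set" where
  "S_inv = {br. invertible_singular br}"

definition S_inv_iso :: "('n::finite bracket \<times> 'n bracket) set" where
  "S_inv_iso = {(br, br'). br \<in> S_inv \<and> br' \<in> S_inv \<and> isomorphic_brackets br br'}"


section \<open>The parameter space\<close>

definition partitions :: "nat list set" where
  "partitions = {ds. ds \<noteq> [] \<and> sorted_wrt (\<ge>) ds \<and> (\<forall>k\<in>set ds. k \<ge> 1)}"

definition \<Phi> :: "nat list \<Rightarrow> nat" where
  "\<Phi> ds = sum_list ds"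

text \<open>Functions on \<open>\<Lambda>\<close> are represented by extensional functions (equal to \<^const>\<open>undefined\<close>
  outside \<open>\<Lambda>\<close>), so that equality of triples only involves values on \<open>\<Lambda>\<close>.\<close>

type_synonym jdata = "complex set \<times> (complex \<Rightarrow> nat) \<times> (complex \<Rightarrow> nat list)"

definition J :: "nat \<Rightarrow> jdata set" where
  "J p = {(\<Lambda>, m, d).
     \<Lambda> \<subseteq> - {0} \<and> finite \<Lambda> \<and> card \<Lambda> \<le> 2 * p \<and> (\<forall>z. z \<in> \<Lambda> \<longleftrightarrow> - z \<in> \<Lambda>) \<and>
     m \<in> \<Lambda> \<rightarrow>\<^sub>E {1..} \<and> (\<forall>z\<in>\<Lambda>. m z = m (- z)) \<and> (\<Sum>z\<in>\<Lambda>. m z) = 2 * p \<and>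
     d \<in> \<Lambda> \<rightarrow>\<^sub>E partitions \<and> (\<forall>z\<in>\<Lambda>. d z = d (- z)) \<and> (\<forall>z\<in>\<Lambda>. \<Phi> (d z) = m z)}"

fun scale_jdata :: "complex \<Rightarrow> jdata \<Rightarrow> jdata" where
  "scale_jdata \<mu> (\<Lambda>, m, d) =
     ((\<lambda>z. \<mu> * z) ` \<Lambda>,
      restrict (\<lambda>\<nu>. m (\<nu> / \<mu>)) ((\<lambda>z. \<mu> * z) ` \<Lambda>),
      restrict (\<lambda>\<nu>. d (\<nu> / \<mu>)) ((\<lambda>z. \<mu> * z) ` \<Lambda>))"

definition J_orbit_rel :: "nat \<Rightarrow> (jdata \<times> jdata) set" where
  "J_orbit_rel p = {(t, t'). t \<in> J p \<and> (\<exists>\<mu>. \<mu> \<noteq> 0 \<and> t' = scale_jdata \<mu> t)}"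

text \<open>
  \<open>jordan_data C q (\<Lambda>, m, d)\<close>: \<open>C\<close> on the subspace \<open>q\<close> has spectrum \<open>\<Lambda>\<close>, algebraic
  multiplicities \<open>m\<close> and Jordan block sizes \<open>d z\<close> (in decreasing order) for the eigenvalue \<open>z\<close>.
  It is witnessed by a Jordan basis \<open>e\<close> of \<open>q\<close>, where \<open>e (z, i, j)\<close> is the \<open>j\<close>-th vector of the
  chain of the \<open>i\<close>-th block for \<open>z\<close>.
\<close>

definition jordan_data :: "(complex^'n \<Rightarrow> complex^'n::finite) \<Rightarrow> (complex^'n) set \<Rightarrow> jdata \<Rightarrow> bool" where
  "jordan_data C q = (\<lambda>(\<Lambda>, m, d).
     d \<in> \<Lambda> \<rightarrow>\<^sub>E partitions \<and> m = restrict (\<lambda>z. \<Phi> (d z)) \<Lambda> \<and>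
     (\<exists>e :: complex \<times> nat \<times> nat \<Rightarrow> complex^'n.
        let I = {(z, i, j). z \<in> \<Lambda> \<and> i < length (d z) \<and> j < d z ! i} in
        inj_on e I \<and> vec.independent (e ` I) \<and> vec.span (e ` I) = q \<and>
        (\<forall>(z, i, j)\<in>I. C (e (z, i, j)) =
           z *s e (z, i, j) + (if j = 0 then 0 else e (z, i, j - 1)))))"

end

theory Submission
  imports Defs "HOL-Computational_Algebra.Fundamental_Theorem_Algebra"
begin

text \<open>
Write \<open>V\<close> for \<open>\<complex>\<^sup>n\<close>. In a decomposition with isotropic vectors \<open>x = X0\<close>, \<open>y = Y0\<close>, the operator
\<open>A = ad y\<close> kills \<open>x\<close> and \<open>y\<close> and is skew-symmetric on all of \<open>V\<close>, and the bracket is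
\<open>[Z, W] = \<langle>x,Z\<rangle> A W - \<langle>x,W\<rangle> A Z + \<langle>A Z,W\<rangle> x\<close>. The whole structure is thus a skew-symmetric operator with
a hyperbolic pair in its kernel, and \<open>q\<close> is the orthogonal complement of that pair. The map sends a
class of brackets to all Jordan data of all decompositions of its members, so the content of the
theorem is that this set is exactly one orbit, that it determines the class, and that every orbit occurs.

A Jordan basis of \<open>A\<close> on \<open>q\<close> exists (\<open>jordan_data_exists\<close>), and its block sizes are read off from the
dimensions of the images of the powers of \<open>A - z\<close> (\<open>jordan_data_unique\<close>). The basis dual to a Jordan
basis for the form is, up to signs and order, a Jordan basis with negated eigenvalues
(\<open>jordan_data_uminus\<close>); uniqueness then gives the symmetry required in the parameter space.

If \<open>A\<close> is injective on \<open>q\<close>, the line of \<open>x\<close> is the centre of the algebra. A Lie isomorphism therefore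
respects this line, and it induces an isomorphism of the spaces \<open>q\<close> that conjugates \<open>A\<close> into a
multiple of \<open>A'\<close>, the factor being the coefficient of \<open>y'\<close> in the image of \<open>y\<close>
(\<open>isomorphism_scales_jordan_data\<close>). Taking the identity as isomorphism shows the independence of the
decomposition. Rescaling \<open>(x, y)\<close> to \<open>(x/\<mu>, \<mu> y)\<close> realizes every point of the orbit.

Conversely, equal Jordan data give a linear \<open>\<phi>\<close> with \<open>\<phi> A = A' \<phi>\<close>, but a Lie isomorphism also has to
respect \<open>\<langle>A Z,W\<rangle>\<close>. The operator \<open>S = \<phi>\<^sup>T \<phi>\<close> is invertible, symmetric and commutes with \<open>A\<close>; it has a
square root \<open>R\<close> that is a polynomial in \<open>S\<close> (\<open>symmetric_square_root\<close>), and \<open>\<phi> R\<^sup>-\<^sup>1\<close> is an isometry that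
still intertwines \<open>A\<close> and \<open>A'\<close> (\<open>similar_skew_isometric\<close>).

Finally each parameter is realized by a sum of elementary skew maps on a hyperbolic basis indexed by the
Jordan positions with eigenvalue in a half-plane (\<open>jordan_data_realized\<close>).
\<close>

section \<open>The bilinear form and linear maps\<close>

abbreviation clinear :: "(complex^'a \<Rightarrow> complex^'b) \<Rightarrow> bool" where
  "clinear \<equiv> Vector_Spaces.linear (*s) (*s)"

abbreviation sp :: "complex^'n \<Rightarrow> complex^'n \<Rightarrow> complex" (infixl "\<bullet>\<^sub>c" 70) where
  "x \<bullet>\<^sub>c y \<equiv> scalar_product x y"

lemma sp_commute: "x \<bullet>\<^sub>c y = y \<bullet>\<^sub>c (x :: complex^'n)"
  by (simp add: scalar_product_def mult.commute)

lemma sp_simps [simp]: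
  fixes x y z :: "complex^'n"
  shows "(x + y) \<bullet>\<^sub>c z = x \<bullet>\<^sub>c z + y \<bullet>\<^sub>c z" "x \<bullet>\<^sub>c (y + z) = x \<bullet>\<^sub>c y + x \<bullet>\<^sub>c z"
    "(x - y) \<bullet>\<^sub>c z = x \<bullet>\<^sub>c z - y \<bullet>\<^sub>c z" "x \<bullet>\<^sub>c (y - z) = x \<bullet>\<^sub>c y - x \<bullet>\<^sub>c z"
    "(- x) \<bullet>\<^sub>c z = - (x \<bullet>\<^sub>c z)" "x \<bullet>\<^sub>c (- z) = - (x \<bullet>\<^sub>c z)"
    "(c *s x) \<bullet>\<^sub>c z = c * (x \<bullet>\<^sub>c z)" "x \<bullet>\<^sub>c (c *s z) = c * (x \<bullet>\<^sub>c z)"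
    "0 \<bullet>\<^sub>c z = 0" "x \<bullet>\<^sub>c 0 = 0"
  by (simp_all add: scalar_product_def sum.distrib sum_subtractf sum_negf sum_distrib_left algebra_simps)

lemma sp_sum:
  fixes x :: "complex^'n"
  shows "(\<Sum>i\<in>I. f i) \<bullet>\<^sub>c x = (\<Sum>i\<in>I. f i \<bullet>\<^sub>c x)" "x \<bullet>\<^sub>c (\<Sum>i\<in>I. f i) = (\<Sum>i\<in>I. x \<bullet>\<^sub>c f i)"
  by (induction I rule: infinite_finite_induct; simp)+

lemma sp_axis [simp]: "x \<bullet>\<^sub>c axis i 1 = x $ i" "axis i 1 \<bullet>\<^sub>c x = x $ i"
  by (simp_all add: scalar_product_def axis_def if_distrib if_distribR cong: if_cong)

lemma sp_nondegenerate:
  assumes "\<And>y. x \<bullet>\<^sub>c y = 0"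
  shows "x = 0"
  using assms[of "axis _ 1"] by (simp add: vec_eq_iff)

lemma sp_eqI:
  assumes "\<And>y. x \<bullet>\<^sub>c y = x' \<bullet>\<^sub>c y"
  shows "x = x'"
  using sp_nondegenerate[of "x - x'"] assms by simp

lemma clinear_simps:
  assumes "clinear f"
  shows "f (x + y) = f x + f y" "f (c *s x) = c *s f x" "f 0 = 0" "f (x - y) = f x - f y" "f (- x) = - f x"
    "f (sum g I) = (\<Sum>i\<in>I. f (g i))"
  using assms
  by (auto simp: vec.linear_add vec.linear_scale vec.linear_0 vec.linear_diff vec.linear_neg vec.linear_sum)

lemma clinearI:
  assumes "\<And>x y. f (x + y) = f x + f y" "\<And>c x. f (c *s x) = c *s f x"
  shows "clinear f"
  using assms unfolding Vector_Spaces.linear_iff by (auto intro: vec.vector_space_axioms)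

lemma clinear_ident: "clinear (\<lambda>x. x)" by (rule clinearI) auto

lemma clinear_comp: "clinear f \<Longrightarrow> clinear g \<Longrightarrow> clinear (\<lambda>x. f (g x))"
  by (rule clinearI) (simp_all add: clinear_simps)

lemma clinear_add: "clinear f \<Longrightarrow> clinear g \<Longrightarrow> clinear (\<lambda>x. f x + g x)"
  by (rule clinearI) (simp_all add: clinear_simps vector_add_ldistrib)

lemma clinear_sub: "clinear f \<Longrightarrow> clinear g \<Longrightarrow> clinear (\<lambda>x. f x - g x)"
  by (rule clinearI) (simp_all add: clinear_simps vector_ssub_ldistrib)

lemma clinear_scale: "clinear f \<Longrightarrow> clinear (\<lambda>x. c *s f x)"
  by (rule clinearI) (simp_all add: clinear_simps vector_add_ldistrib vector_smult_assoc mult.commute)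

lemma clinear_sum: "(\<And>i. i \<in> I \<Longrightarrow> clinear (f i)) \<Longrightarrow> clinear (\<lambda>x. \<Sum>i\<in>I. f i x)"
proof (induction I rule: infinite_finite_induct)
  case (insert a I)
  then show ?case using clinear_add[of "f a" "\<lambda>x. \<Sum>i\<in>I. f i x"] by simp
qed (auto intro!: clinearI)

lemma clinear_sp: "clinear (\<lambda>x. (y \<bullet>\<^sub>c x) *s z)"
  by (rule clinearI) (simp_all add: vector_sadd_rdistrib)

lemmas clinear_intros = clinear_ident clinear_add clinear_sub clinear_scale clinear_sum clinear_sp

text \<open>
The transpose for the bilinear (not Hermitian) form.
\<close>

definition sp_adjoint :: "(complex^'n \<Rightarrow> complex^'n) \<Rightarrow> complex^'n \<Rightarrow> complex^'n" where
  "sp_adjoint f y = (\<chi> i. f (axis i 1) \<bullet>\<^sub>c y)"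

lemma sp_adjoint:
  assumes "clinear f"
  shows "x \<bullet>\<^sub>c sp_adjoint f y = f x \<bullet>\<^sub>c y"
proof -
  have "x = (\<Sum>i\<in>UNIV. x $ i *s axis i 1)" by (simp add: basis_expansion)
  then have "f x \<bullet>\<^sub>c y = f (\<Sum>i\<in>UNIV. x $ i *s axis i 1) \<bullet>\<^sub>c y" by simp
  also have "\<dots> = (\<Sum>i\<in>UNIV. x $ i * (f (axis i 1) \<bullet>\<^sub>c y))"
    by (simp add: clinear_simps[OF assms] sp_sum)
  finally show ?thesis by (simp add: sp_adjoint_def scalar_product_def)
qed

lemma sp_adjoint_left: "clinear f \<Longrightarrow> sp_adjoint f x \<bullet>\<^sub>c y = x \<bullet>\<^sub>c f y"
  using sp_adjoint[of f y x] by (simp add: sp_commute)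

lemma clinear_sp_adjoint: "clinear (sp_adjoint f)"
  by (rule clinearI) (simp_all add: sp_adjoint_def vec_eq_iff)

section \<open>Polynomials in an endomorphism\<close>

text \<open>
The value \<open>p(A)\<close>, given by the Horner scheme.
\<close>

definition poly_endo :: "(complex^'n \<Rightarrow> complex^'n) \<Rightarrow> complex poly \<Rightarrow> complex^'n \<Rightarrow> complex^'n" where
  "poly_endo A p = fold_coeffs (\<lambda>a f x. a *s x + A (f x)) p (\<lambda>x. 0)"

lemma poly_endo_0 [simp]: "poly_endo A 0 x = 0" by (simp add: poly_endo_def)

lemma poly_endo_pCons:
  assumes "clinear A" shows "poly_endo A (pCons a p) x = a *s x + A (poly_endo A p x)"
  by (cases "a = 0 \<and> p = 0") (auto simp: poly_endo_def clinear_simps[OF assms])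

lemma clinear_poly_endo:
  assumes "clinear A" shows "clinear (poly_endo A p)"
proof (induction p)
  case 0 show ?case by (rule clinearI) auto
next
  case (pCons a p)
  have "clinear (\<lambda>x. a *s x + A (poly_endo A p x))"
    by (intro clinear_intros clinear_comp[OF assms] pCons)
  moreover have "poly_endo A (pCons a p) = (\<lambda>x. a *s x + A (poly_endo A p x))"
    by (rule ext) (rule poly_endo_pCons[OF assms])
  ultimately show ?case by simp
qed

lemma poly_endo_add:
  assumes A: "clinear A" shows "poly_endo A (p + q) x = poly_endo A p x + poly_endo A q x"
proof (induction p arbitrary: q)
  case (pCons a p)
  then show ?case
    by (cases q) (simp add: poly_endo_pCons[OF A] clinear_simps[OF A] vector_sadd_rdistrib algebra_simps)
qed auto

lemma poly_endo_smult:
  assumes A: "clinear A" shows "poly_endo A (smult c p) x = c *s poly_endo A p x"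
  by (induction p) (simp_all add: poly_endo_pCons[OF A] clinear_simps[OF A] vector_add_ldistrib)

lemma poly_endo_mult:
  assumes A: "clinear A" shows "poly_endo A (p * q) x = poly_endo A p (poly_endo A q x)"
proof (induction p)
  case (pCons a p)
  then show ?case
    by (simp add: mult_pCons_left poly_endo_add[OF A] poly_endo_smult[OF A] poly_endo_pCons[OF A])
qed auto

lemma poly_endo_commute:
  assumes A: "clinear A" and B: "clinear B" and "\<And>x. A (B x) = B (A x)"
  shows "poly_endo A p (B x) = B (poly_endo A p x)"
  by (induction p) (simp_all add: poly_endo_pCons[OF A] clinear_simps[OF B] assms(3))

lemma poly_endo_adjoint:
  assumes A: "clinear A" and "\<And>x y. A x \<bullet>\<^sub>c y = x \<bullet>\<^sub>c A y"
  shows "poly_endo A p x \<bullet>\<^sub>c y = x \<bullet>\<^sub>c poly_endo A p y"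
  by (induction p arbitrary: x y)
    (simp_all add: poly_endo_pCons[OF A] assms(2) poly_endo_commute[OF A A])

lemma poly_endo_sum:
  assumes A: "clinear A" shows "poly_endo A (\<Sum>i\<in>I. p i) x = (\<Sum>i\<in>I. poly_endo A (p i) x)"
  by (induction I rule: infinite_finite_induct) (simp_all add: poly_endo_add[OF A])

lemma poly_endo_monom:
  assumes A: "clinear A" shows "poly_endo A (monom c k) x = c *s (A ^^ k) x"
  by (induction k) (simp_all add: poly_endo_pCons[OF A] clinear_simps[OF A] monom_0 monom_Suc)

text \<open>
The \<open>n + 1\<close> vectors \<open>w, A w, \<dots>, A\<^sup>n w\<close> either repeat or are linearly dependent.
\<close>

lemma annihilating_poly_exists:
  fixes A :: "complex^'n \<Rightarrow> complex^'n"
  assumes A: "clinear A"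
  shows "\<exists>p. p \<noteq> 0 \<and> poly_endo A p w = 0"
proof -
  let ?g = "\<lambda>k. (A ^^ k) w"
  define N where "N = CARD('n)"
  show ?thesis
  proof (cases "inj_on ?g {..N}")
    case False
    then obtain i j where ij: "i \<noteq> j" "?g i = ?g j" by (auto simp: inj_on_def)
    let ?p = "monom 1 i - monom 1 j :: complex poly"
    have "coeff ?p i \<noteq> 0" using ij by simp
    then have "?p \<noteq> 0" by force
    moreover have eq: "?p = monom 1 i + monom (-1) j" by (simp add: minus_monom)
    have "poly_endo A ?p w = 0" unfolding eq poly_endo_add[OF A] poly_endo_monom[OF A] by (simp add: ij)
    ultimately show ?thesis by blast
  next
    case True
    have "card (?g ` {..N}) = N + 1" using True by (simp add: card_image)
    then have "vec.dependent (?g ` {..N})"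
      using vec.dependent_biggerset_general[of "?g ` {..N}"]
      by (metis N_def dim_subset_UNIV_cart_gen finite_atMost finite_imageI less_add_one order_le_less_trans)
    then obtain u where u: "\<exists>v\<in>?g ` {..N}. u v \<noteq> 0" "(\<Sum>v\<in>?g ` {..N}. u v *s v) = 0"
      using vec.dependent_finite[of "?g ` {..N}"] by auto
    then obtain k0 where k0: "k0 \<le> N" "u (?g k0) \<noteq> 0" by auto
    let ?p = "\<Sum>k\<le>N. monom (u (?g k)) k"
    have "coeff ?p k0 \<noteq> 0" using k0 by (simp add: coeff_sum)
    then have "?p \<noteq> 0" by force
    moreover have "poly_endo A ?p w = 0"
      using u(2) by (simp add: poly_endo_sum[OF A] poly_endo_monom[OF A] sum.reindex[OF True])
    ultimately show ?thesis by blast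
  qed
qed

text \<open>
Split off the linear factors of a polynomial annihilating \<open>w\<close> one at a time: the first factor that maps
the current vector to \<open>0\<close> exhibits that vector as an eigenvector.
\<close>

lemma eigenvector_in_invariant_subspace:
  fixes A :: "complex^'n \<Rightarrow> complex^'n"
  assumes A: "clinear A" and S: "vec.subspace S" and inv: "\<And>x. x \<in> S \<Longrightarrow> A x \<in> S"
    and w: "w \<in> S" "w \<noteq> 0"
  shows "\<exists>z v. v \<in> S \<and> v \<noteq> 0 \<and> A v = z *s v"
proof -
  have "p \<noteq> 0 \<Longrightarrow> w \<in> S \<Longrightarrow> w \<noteq> 0 \<Longrightarrow> poly_endo A p w = 0 \<Longrightarrow> \<exists>z v. v \<in> S \<and> v \<noteq> 0 \<and> A v = z *s v" for p w
  proof (induction "degree p" arbitrary: p w)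
    case 0
    then obtain c where "p = [:c:]" "c \<noteq> 0" by (metis degree_eq_zeroE pCons_0_0)
    then show ?case using 0 by (simp add: poly_endo_pCons[OF A] clinear_simps[OF A])
  next
    case (Suc n)
    then have "\<not> constant (poly p)" by (metis constant_degree Zero_not_Suc)
    then obtain z where "poly p z = 0" using fundamental_theorem_of_algebra by blast
    then obtain p' where p': "p = p' * [:-z,1:]" by (metis dvdE mult.commute poly_eq_0_iff_dvd)
    let ?w = "A w - z *s w"
    have w': "poly_endo A [:-z,1:] w = ?w" by (simp add: poly_endo_pCons[OF A] clinear_simps[OF A] vec_eq_iff)
    show ?case
    proof (cases "?w = 0")
      case True then show ?thesis using Suc by auto
    next
      case False
      have "p' \<noteq> 0" using p' Suc by auto
      then have deg: "n = degree p'" using p' Suc(2) by (subst (asm) p', subst (asm) degree_mult_eq) auto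
      have "?w \<in> S" using inv Suc S by (simp add: vec.subspace_diff vec.subspace_scale)
      moreover have "poly_endo A p' ?w = 0" using Suc.prems(4) unfolding p' poly_endo_mult[OF A] w' .
      ultimately show ?thesis using Suc.hyps(1)[OF deg \<open>p' \<noteq> 0\<close> _ False] by blast
    qed
  qed
  then show ?thesis using annihilating_poly_exists[OF A] w by blast
qed

text \<open>
The indeterminate is a square modulo \<open>f\<close>, by induction on the linear factors of \<open>f\<close>. If
\<open>r\<^sup>2 - X = h g\<close> and a factor \<open>X - z\<close> is added to \<open>h\<close>, correct \<open>r\<close> to \<open>r + c h\<close>; the condition on \<open>c\<close> is that
\<open>g + 2 c r + c\<^sup>2 h\<close> vanishes at \<open>z\<close>. This is a quadratic equation if \<open>h(z) \<noteq> 0\<close>. Otherwise it is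
linear with leading coefficient \<open>2 r(z)\<close>, which is nonzero because \<open>r(z)\<^sup>2 = z \<noteq> 0\<close>.
\<close>

lemma poly_sqrt_mod:
  fixes f :: "complex poly"
  assumes "poly f 0 \<noteq> 0"
  shows "\<exists>r. f dvd r * r - [:0,1:]"
  using assms
proof (induction "degree f" arbitrary: f)
  case 0
  then obtain c where "f = [:c:]" "c \<noteq> 0" by (metis degree_eq_zeroE poly_0 pCons_0_0)
  then show ?case by (metis is_unit_const_poly_iff is_unit_pCons_iff unit_imp_dvd)
next
  case (Suc n)
  then have "\<not> constant (poly f)" by (metis constant_degree Zero_not_Suc)
  then obtain z where "poly f z = 0" using fundamental_theorem_of_algebra by blast
  then obtain h where h: "f = [:-z,1:] * h" by (metis dvdE poly_eq_0_iff_dvd)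
  have "h \<noteq> 0" using h Suc by auto
  then have deg: "n = degree h" using h Suc(2) by (subst (asm) h, subst (asm) degree_mult_eq) auto
  have z0: "z \<noteq> 0" and h0: "poly h 0 \<noteq> 0" using Suc.prems h by auto
  obtain r g where rg: "r * r - [:0,1:] = h * g" using Suc.hyps(1)[OF deg h0] by (auto elim: dvdE)
  have "\<exists>c. poly g z + 2 * poly r z * c + poly h z * c\<^sup>2 = 0"
  proof (cases "poly h z = 0")
    case True
    have "poly (r * r - [:0,1:]) z = 0" using rg True by simp
    then have "poly r z \<noteq> 0" using z0 by auto
    then show ?thesis using True by (intro exI[of _ "- poly g z / (2 * poly r z)"]) simp
  next
    case False
    let ?P = "[:poly g z, 2 * poly r z, poly h z:]"
    have "\<not> constant (poly ?P)" using False by (simp add: constant_degree)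
    then obtain c where "poly ?P c = 0" using fundamental_theorem_of_algebra by blast
    then show ?thesis by (intro exI[of _ c]) (simp add: algebra_simps power2_eq_square)
  qed
  then obtain c where c: "poly g z + 2 * poly r z * c + poly h z * c\<^sup>2 = 0" by blast
  define k where "k = [:c:]"
  let ?r = "r + k * h"
  have "?r * ?r - [:0,1:] = h * (g + 2 * k * r + k * k * h)"
    using rg by (simp add: algebra_simps)
  moreover have "[:-z,1:] dvd g + 2 * k * r + k * k * h"
    using c by (simp add: poly_eq_0_iff_dvd[symmetric] k_def power2_eq_square algebra_simps)
  ultimately show ?case using h by (metis dvd_refl mult.commute mult_dvd_mono)
qed

text \<open>
For an injective operator a factor \<open>X\<close> of an annihilating polynomial can be cancelled, so the constant
term may be taken nonzero; the product over a basis then annihilates all vectors.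
\<close>

lemma annihilating_poly_inj:
  fixes S :: "complex^'n \<Rightarrow> complex^'n"
  assumes S: "clinear S" and inj: "\<And>x. S x = 0 \<Longrightarrow> x = 0"
  shows "\<exists>p. poly p 0 \<noteq> 0 \<and> (\<forall>w. poly_endo S p w = 0)"
proof -
  have 1: "\<exists>p. poly p 0 \<noteq> 0 \<and> poly_endo S p w = 0" for w
  proof -
    obtain p where p: "p \<noteq> 0" "poly_endo S p w = 0" using annihilating_poly_exists[OF S] by blast
    then show ?thesis
    proof (induction p)
      case (pCons a p)
      show ?case
      proof (cases "a = 0")
        case True
        then have "S (poly_endo S p w) = 0" using pCons by (simp add: poly_endo_pCons[OF S])
        then have "poly_endo S p w = 0" using inj by blast
        then show ?thesis using pCons True by auto
      next
        case False then show ?thesis using pCons.prems by (intro exI[of _ "pCons a p"]) auto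
      qed
    qed auto
  qed
  have 2: "\<exists>p. poly p 0 \<noteq> 0 \<and> (\<forall>w\<in>W. poly_endo S p w = 0)" if "finite W" for W
    using that
  proof (induction W)
    case empty show ?case by (intro exI[of _ 1]) auto
  next
    case (insert w W)
    then obtain p where p: "poly p 0 \<noteq> 0" "\<forall>w\<in>W. poly_endo S p w = 0" by blast
    obtain p' where p': "poly p' 0 \<noteq> 0" "poly_endo S p' w = 0" using 1 by blast
    have "poly_endo S (p * p') v = 0" if "v \<in> insert w W" for v
    proof (cases "v = w")
      case True then show ?thesis
        using p' by (simp add: poly_endo_mult[OF S] clinear_simps[OF clinear_poly_endo[OF S]])
    next
      case False then show ?thesis
        using p that by (simp add: poly_endo_mult[OF S] mult.commute[of p] clinear_simps[OF clinear_poly_endo[OF S]])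
    qed
    then show ?case using p p' by (intro exI[of _ "p * p'"]) auto
  qed
  obtain p where p: "poly p 0 \<noteq> 0" "\<forall>w\<in>cart_basis. poly_endo S p w = 0"
    using 2[OF finite_cart_basis] by blast
  have "poly_endo S p w = 0" for w
    using vec.linear_eq_0_on_span[OF clinear_poly_endo[OF S], of cart_basis] p by (simp add: span_cart_basis)
  then show ?thesis using p by blast
qed

section \<open>Independent and spanning families\<close>

lemma spanning_family:
  fixes e :: "'i \<Rightarrow> complex^'n"
  assumes "finite I" "vec.subspace W" "e ` I \<subseteq> W" "W \<subseteq> vec.span (e ` I)" "card I \<le> vec.dim W"
  shows "inj_on e I" "vec.independent (e ` I)" "vec.span (e ` I) = W"
proof -
  have fin: "finite (e ` I)" using assms by simp
  have 1: "vec.dim W \<le> card (e ` I)" by (rule vec.dim_le_card) (use assms in auto)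
  moreover have 2: "card (e ` I) \<le> card I" by (rule card_image_le) fact
  ultimately have "card (e ` I) = card I" using assms by simp
  then show "inj_on e I" using assms by (simp add: eq_card_imp_inj_on)
  show "vec.independent (e ` I)"
    using vec.card_le_dim_spanning[of "e ` I" W] assms 1 2 by simp
  show "vec.span (e ` I) = W" using assms by (simp add: subset_antisym vec.span_minimal)
qed

lemma independent_family_spans:
  fixes e :: "'i \<Rightarrow> complex^'n"
  assumes "finite I" "vec.subspace W" "e ` I \<subseteq> W" "inj_on e I" "vec.independent (e ` I)" "card I = vec.dim W"
  shows "vec.span (e ` I) = W"
proof -
  have "W \<subseteq> vec.span (e ` I)"
    using vec.card_ge_dim_independent[of "e ` I" W] assms by (simp add: card_image)
  then show ?thesis using assms by (simp add: subset_antisym vec.span_minimal)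
qed

lemma dual_family_independent:
  fixes f g :: "'i \<Rightarrow> complex^'n"
  assumes I: "finite I" and fg: "\<And>i j. i \<in> I \<Longrightarrow> j \<in> I \<Longrightarrow> f i \<bullet>\<^sub>c g j = (if i = j then 1 else 0)"
  shows "inj_on f I" "vec.independent (f ` I)"
proof -
  show inj: "inj_on f I"
  proof (rule inj_onI)
    fix i j assume ij: "i \<in> I" "j \<in> I" "f i = f j"
    then have "f i \<bullet>\<^sub>c g i = f j \<bullet>\<^sub>c g i" by simp
    then show "i = j" using fg ij(1,2) by (auto split: if_splits)
  qed
  show "vec.independent (f ` I)"
  proof (rule vec.independent_if_scalars_zero)
    fix c v assume s: "(\<Sum>x\<in>f ` I. c x *s x) = 0" and v: "v \<in> f ` I"
    then obtain i where i: "i \<in> I" "v = f i" by auto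
    have "0 = (\<Sum>x\<in>f ` I. c x *s x) \<bullet>\<^sub>c g i" using s by simp
    also have "\<dots> = (\<Sum>j\<in>I. c (f j) * (f j \<bullet>\<^sub>c g i))"
      by (simp add: sum.reindex[OF inj] sp_sum)
    also have "\<dots> = (\<Sum>j\<in>I. if j = i then c (f j) else 0)"
      by (rule sum.cong) (use i fg in auto)
    also have "\<dots> = c v" using i I by simp
    finally show "c v = 0" by simp
  qed (use I in simp)
qed

text \<open>
The half of the rank-nullity formula that bounds the length of a family of Jordan chains.
\<close>

lemma dim_image_kernel_le:
  fixes f :: "complex^'n \<Rightarrow> complex^'n"
  assumes f: "clinear f" and W: "vec.subspace W"
    and M: "M \<subseteq> {x \<in> W. f x = 0}" "vec.independent M"
  shows "vec.dim (f ` W) + card M \<le> vec.dim W"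
proof -
  obtain B where B: "M \<subseteq> B" "B \<subseteq> W" "vec.independent B" "W \<subseteq> vec.span B"
    using vec.maximal_independent_subset_extend[of M W] M by blast
  have fin: "finite B" using B(3) vec.finiteI_independent by blast
  have "f ` W \<subseteq> vec.span (f ` B)"
    using B(4) vec.linear_span_image[OF f, of B] by auto
  also have "f ` B \<subseteq> insert 0 (f ` (B - M))" using M by auto
  then have "vec.span (f ` B) \<subseteq> vec.span (f ` (B - M))"
    using vec.span_mono[of "f ` B" "insert 0 (f ` (B - M))"] by simp
  finally have "vec.dim (f ` W) \<le> card (f ` (B - M))"
    by (rule vec.dim_le_card) (use fin in simp)
  also have "\<dots> \<le> card (B - M)" by (rule card_image_le) (use fin in simp)
  also have "\<dots> = card B - card M" using B fin by (simp add: card_Diff_subset finite_subset)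
  finally have "vec.dim (f ` W) + card M \<le> card B" using B fin by (metis Nat.le_diff_conv2 card_mono)
  also have "card B = vec.dim W" using B by (simp add: vec.basis_card_eq_dim)
  finally show ?thesis .
qed

lemma scaled_eq_solve:
  fixes x y r :: "complex^'n"
  assumes "y = w *s x + r" "w \<noteq> 0"
  shows "x = (1 / w) *s (y - r)"
  using assms by simp

section \<open>Existence of Jordan bases\<close>

text \<open>
A Jordan basis with chains indexed by their bottom vectors: \<open>b\<close> is an eigenvector for \<open>a b\<close>, and \<open>e (b,0) = b\<close>,
\<open>e (b,1)\<close>, and so on form a chain of length \<open>s b\<close>. This indexing survives the induction below, where chains grow only
at their top, and new chains are indexed by new vectors.
\<close>

definition jordan_chains ::
  "(complex^'n \<Rightarrow> complex^'n) \<Rightarrow> (complex^'n) set \<Rightarrow> (complex^'n) set \<Rightarrow> (complex^'n \<Rightarrow> complex)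
    \<Rightarrow> (complex^'n \<Rightarrow> nat) \<Rightarrow> ((complex^'n) \<times> nat \<Rightarrow> complex^'n) \<Rightarrow> bool" where
  "jordan_chains A W K a s e \<longleftrightarrow> finite K \<and>
     (\<forall>b\<in>K. s b \<ge> 1 \<and> e (b,0) = b) \<and>
     (\<forall>b\<in>K. \<forall>j<s b. A (e (b,j)) = a b *s e (b,j) + (if j = 0 then 0 else e (b, j-1))) \<and>
     inj_on e (SIGMA b:K. {..<s b}) \<and> vec.independent (e ` (SIGMA b:K. {..<s b})) \<and>
     vec.span (e ` (SIGMA b:K. {..<s b})) = W"

text \<open>
Induction on the dimension. For an eigenvalue \<open>z\<close> put \<open>B = A - z\<close>; the image \<open>B W\<close> is invariant and
smaller. Extend every chain of \<open>B W\<close> for the eigenvalue \<open>z\<close> by a \<open>B\<close>-preimage of its top vector, and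
complete the bottoms of these chains to a basis of the kernel of \<open>B\<close> on \<open>W\<close>, the new vectors being
chains of length one. The result spans \<open>W\<close>, because its span contains the kernel and its image under
\<open>B\<close> contains all old basis vectors. It is a basis, because its length is \<open>dim (B W) + dim (ker B)\<close>.
\<close>

lemma jordan_chains_exist:
  fixes A :: "complex^'n \<Rightarrow> complex^'n"
  assumes A: "clinear A" and W: "vec.subspace W" and inv: "\<And>x. x \<in> W \<Longrightarrow> A x \<in> W"
  shows "\<exists>K a s e. jordan_chains A W K a s e"
  using W inv
proof (induction "vec.dim W" arbitrary: W rule: less_induct)
  case less
  note W = less.prems(1) and inv = less.prems(2)
  show ?case
  proof (cases "W = {0}")
    case True
    then have "jordan_chains A W {} (\<lambda>_. 0) (\<lambda>_. 1) fst" by (simp add: jordan_chains_def vec.independent_empty)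
    then show ?thesis by blast
  next
    case False
    then obtain w where "w \<in> W" "w \<noteq> 0" using vec.subspace_0[OF W] by blast
    then obtain z v where v: "v \<in> W" "v \<noteq> 0" "A v = z *s v"
      using eigenvector_in_invariant_subspace[OF A W inv] by blast
    define B where "B x = A x - z *s x" for x
    have B: "clinear B" unfolding B_def by (intro clinear_intros A)
    note Bs = clinear_simps[OF B] and As = clinear_simps[OF A]
    define N where "N = {x \<in> W. B x = 0}"
    have BW: "B x \<in> W" if "x \<in> W" for x
      using that inv W by (simp add: B_def vec.subspace_diff vec.subspace_scale)
    then have BWW: "B ` W \<subseteq> W" by auto
    have W': "vec.subspace (B ` W)" using B W by (rule vec.linear_subspace_image)
    have inv': "A x \<in> B ` W" if "x \<in> B ` W" for x
    proof -
      obtain y where "y \<in> W" "x = B y" using \<open>x \<in> B ` W\<close> by blast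
      then have "A x = B (A y)" by (simp add: B_def As)
      then show ?thesis using inv \<open>y \<in> W\<close> by blast
    qed
    have "vec.dim (B ` W) + card {v} \<le> vec.dim W"
      by (rule dim_image_kernel_le[OF B W]) (use v in \<open>auto simp: B_def\<close>)
    then have "vec.dim (B ` W) < vec.dim W" by simp
    from less.hyps[OF this W'] inv' obtain K' a' s' e' where jc: "jordan_chains A (B ` W) K' a' s' e'"
      by blast
    have K': "finite K'" and s': "\<And>b. b \<in> K' \<Longrightarrow> s' b \<ge> 1" and e0: "\<And>b. b \<in> K' \<Longrightarrow> e' (b,0) = b"
      and ch: "\<And>b j. b \<in> K' \<Longrightarrow> j < s' b \<Longrightarrow> A (e' (b,j)) = a' b *s e' (b,j) + (if j = 0 then 0 else e' (b, j-1))"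
      and inj': "inj_on e' (SIGMA b:K'. {..<s' b})"
      and ind': "vec.independent (e' ` (SIGMA b:K'. {..<s' b}))"
      and sp': "vec.span (e' ` (SIGMA b:K'. {..<s' b})) = B ` W"
      using jc unfolding jordan_chains_def by blast+
    have eW': "e' (b,j) \<in> B ` W" if "b \<in> K'" "j < s' b" for b j
      using that vec.span_superset[of "e' ` (SIGMA b:K'. {..<s' b})"] unfolding sp' by auto
    have eW: "e' (b,j) \<in> W" if "b \<in> K'" "j < s' b" for b j
      using eW'[OF that] BWW by (rule rev_subsetD)
    define Kz where "Kz = {b \<in> K'. a' b = z}"
    have bW: "b \<in> W" if "b \<in> K'" for b using eW[of b 0] that s'[of b] e0[of b] by simp
    have Ab: "A b = a' b *s b" if "b \<in> K'" for b
      using ch[of b 0] that s'[of b] by (simp add: e0)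
    have "Kz \<subseteq> N"
      using bW Ab by (auto simp: Kz_def N_def B_def)
    moreover have "Kz \<subseteq> e' ` (SIGMA b:K'. {..<s' b})"
    proof
      fix b assume "b \<in> Kz"
      then have "b = e' (b,0)" "(b,0) \<in> (SIGMA b:K'. {..<s' b})"
        using e0 s'[of b] by (auto simp: Kz_def)
      then show "b \<in> e' ` (SIGMA b:K'. {..<s' b})" by blast
    qed
    then have "vec.independent Kz" using ind' vec.independent_mono by blast
    ultimately obtain M where M: "Kz \<subseteq> M" "M \<subseteq> N" "vec.independent M" "N \<subseteq> vec.span M"
      using vec.maximal_independent_subset_extend[of Kz N] by blast
    have finM: "finite M" using M vec.finiteI_independent by blast
    define L where "L = M - Kz"
    have bn0: "b \<noteq> 0" if "b \<in> K'" for b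
    proof
      assume "b = 0"
      then have "e' (b, 0) = 0" "(b, 0) \<in> (SIGMA b:K'. {..<s' b})" using that e0[of b] s'[of b] by auto
      then have "0 \<in> e' ` (SIGMA b:K'. {..<s' b})" by (metis imageI)
      from vec.dependent_zero[OF this] show False using ind' by contradiction
    qed
    have disj: "b \<notin> K'" if "b \<in> L" for b
    proof
      assume b: "b \<in> K'"
      have "b \<in> N" using that M(2) unfolding L_def by (meson DiffD1 subsetD)
      then have "A b - z *s b = 0" unfolding N_def B_def by simp
      then have "a' b *s b = z *s b" unfolding Ab[OF b] by simp
      then have "a' b = z" using bn0[OF b] by simp
      then show False using that b by (simp add: L_def Kz_def)
    qed
    have "\<exists>y. y \<in> W \<and> B y = e' (b, s' b - 1)" if "b \<in> K'" for b
    proof -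
      have "e' (b, s' b - 1) \<in> B ` W" using eW'[of b "s' b - 1"] that s'[of b] by simp
      then show ?thesis by (metis imageE)
    qed
    then obtain pre where pre: "\<And>b. b \<in> K' \<Longrightarrow> pre b \<in> W" "\<And>b. b \<in> K' \<Longrightarrow> B (pre b) = e' (b, s' b - 1)"
      by metis
    \<comment> \<open>The old chains for \<open>z\<close> grow by one vector; each vector of \<open>L\<close> is a chain of its own.\<close>
    define K where "K = K' \<union> L"
    define a where "a b = (if b \<in> K' then a' b else z)" for b
    define s where "s b = (if b \<in> K' then if a' b = z then s' b + 1 else s' b else 1)" for b
    define e where "e = (\<lambda>(b,j). if b \<in> K' then if j < s' b then e' (b,j) else pre b else b)"
    define I where "I = (SIGMA b:K. {..<s b})"
    have finK: "finite K" using K' finM by (simp add: K_def L_def)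
    have finI: "finite I" unfolding I_def using finK by simp
    have c1: "\<forall>b\<in>K. s b \<ge> 1 \<and> e (b,0) = b"
    proof
      fix b assume "b \<in> K"
      then show "s b \<ge> 1 \<and> e (b,0) = b" using s'[of b] e0[of b] by (auto simp: s_def e_def)
    qed
    have c2: "A (e (b,j)) = a b *s e (b,j) + (if j = 0 then 0 else e (b, j-1))" if "b \<in> K" "j < s b" for b j
    proof (cases "b \<in> K'")
      case True
      show ?thesis
      proof (cases "j < s' b")
        case lt: True
        then have "j - 1 < s' b" by simp
        then show ?thesis using ch[OF True lt] True lt by (simp add: e_def a_def)
      next
        case False
        then have j: "j = s' b" "a' b = z" using that True by (auto simp: s_def split: if_splits)
        then show ?thesis using True pre(2)[OF True] s'[OF True] by (simp add: e_def a_def B_def algebra_simps)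
      qed
    next
      case False
      then have "b \<in> L" "j = 0" using that by (auto simp: K_def s_def)
      then show ?thesis using M False by (auto simp: e_def a_def L_def N_def B_def)
    qed
    have sub: "e ` I \<subseteq> W"
    proof (clarify)
      fix b j assume "(b,j) \<in> I"
      then have b: "b \<in> K" by (simp add: I_def)
      show "e (b,j) \<in> W"
      proof (cases "b \<in> K'")
        case True then show ?thesis using eW[of b j] pre(1)[of b] by (simp add: e_def)
      next
        case False
        then have "b \<in> N" using b M(2) by (auto simp: K_def L_def)
        then show ?thesis using False by (simp add: e_def N_def)
      qed
    qed
    let ?S = "vec.span (e ` I)"
    have BS: "vec.subspace (B ` ?S)" by (intro vec.linear_subspace_image B vec.subspace_span)
    have eI: "e (b,j) \<in> ?S" if "b \<in> K" "j < s b" for b j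
      by (rule vec.span_base) (use that in \<open>auto simp: I_def\<close>)
    \<comment> \<open>On a chain for \<open>z\<close> the map \<open>B\<close> is the shift; on the other chains it is invertible,
      which is an induction from the bottom.\<close>
    have e'S: "e' (b,j) \<in> B ` ?S" if "b \<in> K'" "j < s' b" for b j
      using that
    proof (induction j)
      case 0
      show ?case
      proof (cases "a' b = z")
        case True
        have "B (e (b,1)) = e' (b,0)" using c2[of b 1] True 0
          by (simp add: K_def s_def B_def a_def algebra_simps) (simp add: e_def)
        moreover have "e (b,1) \<in> ?S" using eI[of b 1] 0 True by (simp add: K_def s_def)
        ultimately show ?thesis by (metis imageI)
      next
        case False
        have "e (b,0) = e' (b,0)" using 0 by (simp add: e_def)
        have "B (e (b,0)) = (a' b - z) *s e (b,0) + 0" using c2[of b 0] 0 False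
          by (simp add: K_def s_def B_def a_def vector_sub_rdistrib)
        from scaled_eq_solve[OF this] have "e (b,0) = (1 / (a' b - z)) *s (B (e (b,0)) - 0)"
          using False by (simp del: vector_sub_rdistrib)
        then have "B ((1 / (a' b - z)) *s e (b,0)) = e' (b,0)"
          using \<open>e (b,0) = e' (b,0)\<close> by (simp only: Bs diff_zero)
        moreover have "(1 / (a' b - z)) *s e (b,0) \<in> ?S"
          by (intro vec.span_scale eI) (use 0 False in \<open>auto simp: K_def s_def\<close>)
        ultimately show ?thesis by (metis imageI)
      qed
    next
      case (Suc j)
      show ?case
      proof (cases "a' b = z")
        case True
        have "B (e (b,Suc (Suc j))) = e (b,Suc j)" using c2[of b "Suc (Suc j)"] True Suc
          by (simp add: K_def s_def B_def a_def algebra_simps)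
        also have "\<dots> = e' (b,Suc j)" using Suc by (simp add: e_def)
        finally have "B (e (b,Suc (Suc j))) = e' (b,Suc j)" .
        moreover have "e (b,Suc (Suc j)) \<in> ?S" using eI[of b "Suc (Suc j)"] Suc True by (simp add: K_def s_def)
        ultimately show ?thesis by (metis imageI)
      next
        case False
        have 1: "e (b,Suc j) = e' (b,Suc j)" "e (b,j) = e' (b,j)" using Suc by (simp_all add: e_def)
        have "B (e (b,Suc j)) = (a' b - z) *s e (b,Suc j) + e (b,j)" using c2[of b "Suc j"] Suc False
          by (simp add: K_def s_def B_def a_def vector_sub_rdistrib algebra_simps)
        from scaled_eq_solve[OF this] have "e' (b,Suc j) = (1 / (a' b - z)) *s (B (e (b,Suc j)) - e' (b,j))"
          using False by (simp only: 1 right_minus_eq not_False_eq_True)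
        moreover have "B (e (b,Suc j)) \<in> B ` ?S"
          by (intro imageI eI) (use Suc False in \<open>auto simp: K_def s_def\<close>)
        moreover have "e' (b,j) \<in> B ` ?S" using Suc by simp
        ultimately show ?thesis using BS by (metis vec.subspace_diff vec.subspace_scale)
      qed
    qed
    have "B ` W \<subseteq> B ` ?S"
      unfolding sp'[symmetric] by (rule vec.span_minimal[OF _ BS]) (use e'S in auto)
    have MS: "M \<subseteq> ?S"
    proof
      fix b assume b: "b \<in> M"
      have "b \<in> K" using b M(1) by (auto simp: K_def L_def Kz_def)
      moreover have "0 < s b" "e (b,0) = b" using c1 \<open>b \<in> K\<close> by auto
      ultimately show "b \<in> ?S" using eI[of b 0] by simp
    qed
    have cov: "W \<subseteq> ?S"
    proof
      fix w assume w: "w \<in> W"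
      then obtain y where y: "y \<in> ?S" "B w = B y" using \<open>B ` W \<subseteq> B ` ?S\<close> by blast
      have "y \<in> W" using y(1) sub W by (meson subsetD vec.span_minimal)
      then have "w - y \<in> N" using w y W by (simp add: N_def Bs vec.subspace_diff)
      then have "w - y \<in> vec.span ?S" using M(4) MS vec.span_mono by blast
      then have "w - y \<in> ?S" by (simp add: vec.span_span)
      then show "w \<in> ?S" using y(1) vec.span_add[of "w - y" "e ` I" y] by simp
    qed
    have "card I = (\<Sum>b\<in>K. s b)" unfolding I_def using finK by (simp add: card_SigmaI)
    also have "\<dots> = (\<Sum>b\<in>K'. s b) + (\<Sum>b\<in>L. s b)"
      unfolding K_def by (rule sum.union_disjoint) (use K' finM disj in \<open>auto simp: L_def\<close>)
    also have "(\<Sum>b\<in>L. s b) = card L" using disj by (simp add: s_def)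
    also have "(\<Sum>b\<in>K'. s b) = (\<Sum>b\<in>K'. s' b + (if a' b = z then 1 else 0))"
      by (rule sum.cong) (auto simp: s_def)
    also have "\<dots> = (\<Sum>b\<in>K'. s' b) + card Kz"
      using K' by (simp add: sum.distrib Kz_def sum.If_cases Int_def)
    also have "(\<Sum>b\<in>K'. s' b) = card (SIGMA b:K'. {..<s' b})" using K' by (simp add: card_SigmaI)
    also have "card (SIGMA b:K'. {..<s' b}) = vec.dim (B ` W)"
      using inj' ind' sp'
      by (metis card_image vec.dim_span_eq_card_independent)
    also have "vec.dim (B ` W) + card Kz + card L = vec.dim (B ` W) + card M"
      using M(1) finM by (simp add: L_def card_Diff_subset finite_subset card_mono)
    also have "\<dots> \<le> vec.dim W"
      by (rule dim_image_kernel_le[OF B W]) (use M in \<open>auto simp: N_def\<close>)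
    finally have "card I \<le> vec.dim W" .
    note fam = spanning_family[OF finI W sub cov this]
    show ?thesis
      by (intro exI[of _ K] exI[of _ a] exI[of _ s] exI[of _ e])
        (use fam finK c1 c2 in \<open>auto simp: I_def jordan_chains_def\<close>)
  qed
qed

section \<open>Jordan data: existence, uniqueness, transport\<close>

definition jordan_index :: "complex set \<Rightarrow> (complex \<Rightarrow> nat list) \<Rightarrow> (complex \<times> nat \<times> nat) set" where
  "jordan_index \<Lambda> d = {(z, i, j). z \<in> \<Lambda> \<and> i < length (d z) \<and> j < d z ! i}"

definition jordan_basis ::
  "(complex^'n \<Rightarrow> complex^'n) \<Rightarrow> (complex^'n) set \<Rightarrow> complex set \<Rightarrow> (complex \<Rightarrow> nat list)
    \<Rightarrow> (complex \<times> nat \<times> nat \<Rightarrow> complex^'n) \<Rightarrow> bool" where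
  "jordan_basis C q \<Lambda> d e \<longleftrightarrow>
     inj_on e (jordan_index \<Lambda> d) \<and> vec.independent (e ` jordan_index \<Lambda> d) \<and>
     vec.span (e ` jordan_index \<Lambda> d) = q \<and>
     (\<forall>z i j. (z, i, j) \<in> jordan_index \<Lambda> d \<longrightarrow>
        C (e (z, i, j)) = z *s e (z, i, j) + (if j = 0 then 0 else e (z, i, j - 1)))"

lemma jordan_data_iff:
  "jordan_data C q (\<Lambda>, m, d) \<longleftrightarrow>
     d \<in> \<Lambda> \<rightarrow>\<^sub>E partitions \<and> m = restrict (\<lambda>z. \<Phi> (d z)) \<Lambda> \<and> (\<exists>e. jordan_basis C q \<Lambda> d e)"
  unfolding jordan_data_def jordan_basis_def jordan_index_def Let_def
  by (simp add: split_def)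

lemma jordan_basis_finite:
  "jordan_basis C q \<Lambda> d e \<Longrightarrow> finite (jordan_index \<Lambda> d)"
  unfolding jordan_basis_def by (metis finite_imageD vec.finiteI_independent)

lemma jordan_basis_card:
  "jordan_basis C q \<Lambda> d e \<Longrightarrow> card (jordan_index \<Lambda> d) = vec.dim q"
  unfolding jordan_basis_def by (metis card_image vec.dim_span_eq_card_independent)

lemma partitions_nonempty: "ds \<in> partitions \<Longrightarrow> 0 < length ds \<and> 0 < ds ! 0"
  by (cases ds) (auto simp: partitions_def)

lemma jordan_basis_spectrum_finite:
  assumes "jordan_basis C q \<Lambda> d e" "\<And>z. z \<in> \<Lambda> \<Longrightarrow> d z \<in> partitions"
  shows "finite \<Lambda>"
proof (rule finite_subset)
  show "\<Lambda> \<subseteq> fst ` jordan_index \<Lambda> d"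
  proof
    fix z assume "z \<in> \<Lambda>"
    then have "(z,0,0) \<in> jordan_index \<Lambda> d"
      using partitions_nonempty[OF assms(2)[of z]] by (simp add: jordan_index_def)
    then show "z \<in> fst ` jordan_index \<Lambda> d" by force
  qed
qed (use jordan_basis_finite[OF assms(1)] in simp)

lemma card_jordan_index: "finite \<Lambda> \<Longrightarrow> card (jordan_index \<Lambda> d) = (\<Sum>z\<in>\<Lambda>. \<Phi> (d z))"
proof -
  assume fin: "finite \<Lambda>"
  have "jordan_index \<Lambda> d = (SIGMA z:\<Lambda>. SIGMA i:{..<length (d z)}. {..<d z ! i})"
    by (auto simp: jordan_index_def)
  then have "card (jordan_index \<Lambda> d) = (\<Sum>z\<in>\<Lambda>. \<Sum>i<length (d z). d z ! i)"
    using fin by (simp add: card_SigmaI)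
  also have "\<dots> = (\<Sum>z\<in>\<Lambda>. \<Phi> (d z))"
    by (simp add: \<Phi>_def sum_list_sum_nth atLeast0LessThan)
  finally show ?thesis .
qed

text \<open>
Only a change of indices: the chains for each eigenvalue are listed by decreasing length.
\<close>

lemma jordan_data_exists:
  fixes A :: "complex^'n \<Rightarrow> complex^'n"
  assumes A: "clinear A" and W: "vec.subspace W" and inv: "\<And>x. x \<in> W \<Longrightarrow> A x \<in> W"
  shows "\<exists>t. jordan_data A W t"
proof -
  obtain K a s e where finK: "finite K"
    and se: "\<forall>b\<in>K. s b \<ge> 1 \<and> e (b,0) = b"
    and ch: "\<forall>b\<in>K. \<forall>j<s b. A (e (b,j)) = a b *s e (b,j) + (if j = 0 then 0 else e (b, j-1))"
    and inj: "inj_on e (SIGMA b:K. {..<s b::nat})"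
    and ind: "vec.independent (e ` (SIGMA b:K. {..<s b}))"
    and sp: "vec.span (e ` (SIGMA b:K. {..<s b})) = W"
    using jordan_chains_exist[OF A W inv] unfolding jordan_chains_def by blast
  define \<Lambda> where "\<Lambda> = a ` K"
  have "\<exists>l. set l = {b\<in>K. a b = z} \<and> distinct l \<and> sorted_wrt (\<lambda>x y. s x \<ge> s y) l" for z
  proof -
    obtain l where l: "set l = {b\<in>K. a b = z}" "distinct l"
      using finite_distinct_list[of "{b\<in>K. a b = z}"] finK by auto
    have "sorted (map s (sort_key s l))" by simp
    then have "sorted_wrt (\<lambda>x y. s x \<ge> s y) (rev (sort_key s l))" by (simp add: sorted_wrt_rev sorted_wrt_map)
    then show ?thesis using l by (intro exI[of _ "rev (sort_key s l)"]) simp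
  qed
  then obtain l where l: "\<And>z. set (l z) = {b\<in>K. a b = z}" "\<And>z. distinct (l z)"
    "\<And>z. sorted_wrt (\<lambda>x y. s x \<ge> s y) (l z)" by metis
  define d where "d = restrict (\<lambda>z. map s (l z)) \<Lambda>"
  define g where "g = (\<lambda>(z, i, j). (l z ! i, j :: nat))"
  define I where "I = (SIGMA b:K. {..<s b})"
  have mem: "l z ! i \<in> K \<and> a (l z ! i) = z" if "i < length (l z)" for z i
    using that l(1)[of z] nth_mem by blast
  have bij: "bij_betw g (jordan_index \<Lambda> d) I"
    unfolding bij_betw_def
  proof
    show "inj_on g (jordan_index \<Lambda> d)"
    proof (rule inj_onI)
      fix x y
      assume 1: "x \<in> jordan_index \<Lambda> d" "y \<in> jordan_index \<Lambda> d" and eq: "g x = g y"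
      obtain z i j z' i' j' where xy: "x = (z, i, j)" "y = (z', i', j')" by (metis prod_cases3)
      note eq = eq[unfolded xy]
      from 1 have lt: "i < length (l z)" "i' < length (l z')" by (auto simp: xy jordan_index_def d_def)
      have "z = z'" using eq mem lt by (metis g_def fst_conv split_conv)
      then show "x = y"
        using eq lt l(2)[of z] by (simp add: xy g_def nth_eq_iff_index_eq)
    qed
    show "g ` jordan_index \<Lambda> d = I"
    proof
      show "g ` jordan_index \<Lambda> d \<subseteq> I"
        using mem by (auto simp: jordan_index_def d_def g_def I_def)
      show "I \<subseteq> g ` jordan_index \<Lambda> d"
      proof
        fix x assume "x \<in> I"
        then obtain b j where x: "x = (b,j)" "b \<in> K" "j < s b" by (auto simp: I_def)
        then have "b \<in> set (l (a b))" by (simp add: l)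
        then obtain i where i: "i < length (l (a b))" "l (a b) ! i = b" by (auto simp: in_set_conv_nth)
        then have "(a b, i, j) \<in> jordan_index \<Lambda> d" "g (a b, i, j) = x"
          using x by (auto simp: jordan_index_def d_def \<Lambda>_def g_def)
        then show "x \<in> g ` jordan_index \<Lambda> d" by force
      qed
    qed
  qed
  have im: "(e \<circ> g) ` jordan_index \<Lambda> d = e ` I"
    using bij_betw_imp_surj_on[OF bij] by (metis image_comp)
  have inj': "inj_on (e \<circ> g) (jordan_index \<Lambda> d)"
    using bij inj by (intro comp_inj_on) (auto simp: bij_betw_def I_def)
  have "jordan_basis A W \<Lambda> d (e \<circ> g)"
    unfolding jordan_basis_def im
  proof (intro conjI allI impI)
    fix z i j assume "(z, i, j) \<in> jordan_index \<Lambda> d"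
    then have z: "i < length (l z)" "j < s (l z ! i)" by (auto simp: jordan_index_def d_def)
    then show "A ((e \<circ> g) (z, i, j)) = z *s (e \<circ> g) (z, i, j) + (if j = 0 then 0 else (e \<circ> g) (z, i, j - 1))"
      using ch mem[OF z(1)] by (simp add: g_def)
  qed (use inj' ind sp in \<open>auto simp: I_def\<close>)
  moreover have "d \<in> \<Lambda> \<rightarrow>\<^sub>E partitions"
  proof -
    have "map s (l z) \<in> partitions" if "z \<in> \<Lambda>" for z
      using that l[of z] se by (auto simp: partitions_def sorted_wrt_map \<Lambda>_def)
    then show ?thesis by (simp add: d_def)
  qed
  ultimately show ?thesis using jordan_data_iff by blast
qed

text \<open>
\<open>A - z\<close> shifts the chains for \<open>z\<close> down by one and is bijective on the span of the others, so the image of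
its \<open>k\<close>-th power is spanned by the basis vectors that are counted on the right.
\<close>

lemma rank_from_jordan_basis:
  assumes A: "clinear A" and e: "jordan_basis A q \<Lambda> d e"
  shows "vec.dim (((\<lambda>x. A x - z *s x) ^^ k) ` q) =
    card {(z', i, j) \<in> jordan_index \<Lambda> d. z' \<noteq> z \<or> j + k < d z' ! i}"
proof -
  define B where "B x = A x - z *s x" for x
  have B: "clinear B" unfolding B_def by (intro clinear_intros A)
  define I where "I = jordan_index \<Lambda> d"
  define E where "E k = {(z', i, j) \<in> jordan_index \<Lambda> d. z' \<noteq> z \<or> j + k < d z' ! i}" for k
  have Be: "B (e (z',i,j)) = (z' - z) *s e (z',i,j) + (if j = 0 then 0 else e (z',i,j-1))"
    if "(z',i,j) \<in> I" for z' i j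
    using e that by (simp add: jordan_basis_def B_def I_def vector_sub_rdistrib)
  have step: "B ` vec.span (e ` E k) = vec.span (e ` E (Suc k))" for k
  proof
    have "B (e (z',i,j)) \<in> vec.span (e ` E (Suc k))" if E: "(z',i,j) \<in> E k" for z' i j
    proof -
      have I: "(z',i,j) \<in> I" using E by (auto simp: E_def I_def)
      have 1: "(z' - z) *s e (z',i,j) \<in> vec.span (e ` E (Suc k))"
      proof (cases "z' = z")
        case False
        then have "(z',i,j) \<in> E (Suc k)" using E by (auto simp: E_def)
        then show ?thesis by (intro vec.span_scale vec.span_base) auto
      qed (simp add: vec.span_zero)
      have 2: "(if j = 0 then 0 else e (z',i,j-1)) \<in> vec.span (e ` E (Suc k))"
      proof (cases "j = 0")
        case False
        then have "(z',i,j-1) \<in> E (Suc k)" using E by (auto simp: E_def jordan_index_def)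
        then have "e (z',i,j-1) \<in> vec.span (e ` E (Suc k))" by (intro vec.span_base) auto
        then show ?thesis using False by simp
      qed (simp add: vec.span_zero)
      show ?thesis unfolding Be[OF I] by (intro vec.span_add 1 2)
    qed
    then have "B ` e ` E k \<subseteq> vec.span (e ` E (Suc k))" by auto
    then show "B ` vec.span (e ` E k) \<subseteq> vec.span (e ` E (Suc k))"
      by (simp add: vec.linear_span_image[OF B, symmetric] vec.span_minimal)
    let ?S = "vec.span (B ` e ` E k)"
    have "e (z',i,j) \<in> ?S" if "(z',i,j) \<in> E (Suc k)" for z' i j
    proof (cases "z' = z")
      case True
      then have E: "(z',i,Suc j) \<in> E k" using that by (auto simp: E_def jordan_index_def)
      then have "(z',i,Suc j) \<in> I" by (auto simp: E_def I_def)
      then have "B (e (z',i,Suc j)) = e (z',i,j)" using True by (simp add: Be)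
      then show ?thesis using E by (metis imageI vec.span_base)
    next
      case False
      show ?thesis using that
      proof (induction j)
        case 0
        then have E: "(z',i,0) \<in> E k" and I: "(z',i,0) \<in> I" by (auto simp: E_def I_def)
        have "e (z',i,0) = (1 / (z' - z)) *s (B (e (z',i,0)) - 0)"
          by (rule scaled_eq_solve) (use Be[OF I] False in simp_all)
        then have "e (z',i,0) = (1 / (z' - z)) *s B (e (z',i,0))" by (simp only: diff_zero)
        then show ?case using E by (metis imageI vec.span_base vec.span_scale)
      next
        case (Suc j)
        then have E: "(z',i,Suc j) \<in> E k" "(z',i,j) \<in> E (Suc k)" and I: "(z',i,Suc j) \<in> I"
          using False by (auto simp: E_def I_def jordan_index_def)
        have "e (z',i,Suc j) = (1 / (z' - z)) *s (B (e (z',i,Suc j)) - e (z',i,j))"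
          by (rule scaled_eq_solve) (use Be[OF I] False in simp_all)
        moreover have "B (e (z',i,Suc j)) - e (z',i,j) \<in> ?S"
          using Suc.IH[OF E(2)] E(1) by (intro vec.span_diff) (auto intro: vec.span_base)
        ultimately show ?case by (metis vec.span_scale)
      qed
    qed
    then have "vec.span (e ` E (Suc k)) \<subseteq> ?S" by (intro vec.span_minimal) auto
    then show "vec.span (e ` E (Suc k)) \<subseteq> B ` vec.span (e ` E k)"
      by (simp add: vec.linear_span_image[OF B])
  qed
  have "(B ^^ k) ` q = vec.span (e ` E k)"
  proof (induction k)
    case 0
    have "E 0 = jordan_index \<Lambda> d" by (auto simp: E_def jordan_index_def)
    then show ?case using e by (simp add: jordan_basis_def)
  next
    case (Suc k)
    have "(B ^^ Suc k) ` q = B ` (B ^^ k) ` q" by (simp add: image_comp)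
    then show ?case using Suc step by simp
  qed
  moreover have "E k \<subseteq> jordan_index \<Lambda> d" by (auto simp: E_def)
  then have "vec.independent (e ` E k)" "inj_on e (E k)"
    using e unfolding jordan_basis_def by (meson vec.independent_mono image_mono inj_on_subset)+
  then have "vec.dim (vec.span (e ` E k)) = card (E k)"
    by (metis card_image vec.dim_span_eq_card_independent)
  ultimately show ?thesis by (simp add: B_def[abs_def] E_def)
qed

text \<open>
Passing from \<open>k\<close> to \<open>k + 1\<close> loses one basis vector for each block of size greater than \<open>k\<close>. Hence the ranks
determine the number of such blocks for every \<open>k\<close>.
\<close>

lemma card_jordan_index_shift:
  fixes z :: complex
  assumes fin: "finite (jordan_index \<Lambda> d)"
  defines "D \<equiv> if z \<in> \<Lambda> then d z else []"
  shows "card {(z', i, j) \<in> jordan_index \<Lambda> d. z' \<noteq> z \<or> j + k < d z' ! i} =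
    card {(z', i, j) \<in> jordan_index \<Lambda> d. z' \<noteq> z \<or> j + Suc k < d z' ! i} + length (filter (\<lambda>n. k < n) D)"
proof -
  let ?E = "\<lambda>k. {(z', i, j) \<in> jordan_index \<Lambda> d. z' \<noteq> z \<or> j + k < d z' ! i}"
  let ?R = "{i. i < length D \<and> k < D ! i}"
  let ?h = "\<lambda>i. (z, i, D ! i - Suc k)"
  have "?E k = ?E (Suc k) \<union> ?h ` ?R"
  proof (rule set_eqI, clarify)
    fix z' i j
    show "(z',i,j) \<in> ?E k \<longleftrightarrow> (z',i,j) \<in> ?E (Suc k) \<union> ?h ` ?R"
      by (cases "z' = z") (auto simp: jordan_index_def D_def image_iff)
  qed
  moreover have "?E (Suc k) \<inter> ?h ` ?R = {}" by (auto simp: D_def jordan_index_def split: if_splits)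
  moreover have "finite (?E (Suc k))" using fin by (rule rev_finite_subset) auto
  ultimately have "card (?E k) = card (?E (Suc k)) + card (?h ` ?R)"
    by (simp add: card_Un_disjoint)
  moreover have "card (?h ` ?R) = card ?R" by (rule card_image) (auto intro: inj_onI)
  ultimately show ?thesis by (simp add: length_filter_conv_card)
qed

lemma descending_list_eqI:
  fixes l l' :: "nat list"
  assumes cnt: "\<And>k. length (filter (\<lambda>n. k < n) l) = length (filter (\<lambda>n. k < n) l')"
    and desc: "sorted_wrt (\<ge>) l" "sorted_wrt (\<ge>) l'"
    and pos: "\<forall>k\<in>set l. k \<ge> 1" "\<forall>k\<in>set l'. k \<ge> 1"
  shows "l = l'"
proof -
  have aux: "length (filter (\<lambda>n. k < n) l) = count (mset l) (Suc k) + length (filter (\<lambda>n. Suc k < n) l)" for k and l :: "nat list"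
    by (induction l) auto
  have "count (mset l) k = count (mset l') k" for k
  proof (cases k)
    case 0
    have "0 \<notin># mset l" "0 \<notin># mset l'" using pos by force+
    then show ?thesis unfolding 0 by (simp only: not_in_iff)
  next
    case (Suc k')
    then show ?thesis using aux[of k' l] aux[of k' l'] cnt by simp
  qed
  then have "mset l = mset l'" by (rule multiset_eqI)
  then have "mset (rev l) = mset (rev l')" by simp
  moreover have "sorted (rev l)" "sorted (rev l')" using desc by (simp_all add: sorted_wrt_rev)
  ultimately have "rev l = rev l'" by (metis properties_for_sort)
  then show ?thesis by simp
qed

lemma jordan_data_unique:
  assumes A: "clinear A" and t: "jordan_data A q t" and t': "jordan_data A q t'"
  shows "t = t'"
proof -
  obtain \<Lambda> m d \<Lambda>' m' d' where tt: "t = (\<Lambda>, m, d)" "t' = (\<Lambda>', m', d')" by (metis prod_cases3)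
  obtain e where d: "d \<in> \<Lambda> \<rightarrow>\<^sub>E partitions" "m = restrict (\<lambda>z. \<Phi> (d z)) \<Lambda>" and e: "jordan_basis A q \<Lambda> d e"
    using t tt jordan_data_iff by metis
  obtain e' where d': "d' \<in> \<Lambda>' \<rightarrow>\<^sub>E partitions" "m' = restrict (\<lambda>z. \<Phi> (d' z)) \<Lambda>'" and e': "jordan_basis A q \<Lambda>' d' e'"
    using t' tt jordan_data_iff by metis
  define D where "D z = (if z \<in> \<Lambda> then d z else [])" for z
  define D' where "D' z = (if z \<in> \<Lambda>' then d' z else [])" for z
  have DD: "D z = D' z" for z
  proof (rule descending_list_eqI)
    fix k
    show "length (filter (\<lambda>n. k < n) (D z)) = length (filter (\<lambda>n. k < n) (D' z))"
      using card_jordan_index_shift[OF jordan_basis_finite[OF e], of z k]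
        card_jordan_index_shift[OF jordan_basis_finite[OF e'], of z k]
      unfolding rank_from_jordan_basis[OF A e, symmetric] rank_from_jordan_basis[OF A e', symmetric]
        D_def D'_def by linarith
  qed (use d d' in \<open>auto simp: D_def D'_def partitions_def PiE_iff\<close>)
  have "D z \<noteq> [] \<longleftrightarrow> z \<in> \<Lambda>" for z using d by (auto simp: D_def partitions_def PiE_iff)
  moreover have "D' z \<noteq> [] \<longleftrightarrow> z \<in> \<Lambda>'" for z using d' by (auto simp: D'_def partitions_def PiE_iff)
  ultimately have L: "\<Lambda> = \<Lambda>'" using DD by (metis set_eqI)
  have "d = d'"
  proof (rule PiE_ext[OF d(1)])
    show "d' \<in> \<Lambda> \<rightarrow>\<^sub>E partitions" using d' L by simp
    fix z assume "z \<in> \<Lambda>" then show "d z = d' z" using DD[of z] L by (simp add: D_def D'_def)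
  qed
  then show ?thesis using tt L d d' by simp
qed

lemma jordan_index_scale:
  assumes "\<mu> \<noteq> 0"
  shows "jordan_index ((\<lambda>z. \<mu> * z) ` \<Lambda>) (restrict (\<lambda>\<nu>. d (\<nu> / \<mu>)) ((\<lambda>z. \<mu> * z) ` \<Lambda>)) =
    (\<lambda>(z, i, j). (\<mu> * z, i, j)) ` jordan_index \<Lambda> d"
  using assms by (auto simp: jordan_index_def image_iff)

lemma card_jordan_index_scale:
  assumes "\<mu> \<noteq> 0"
  shows "card (jordan_index ((\<lambda>z. \<mu> * z) ` \<Lambda>) (restrict (\<lambda>\<nu>. d (\<nu> / \<mu>)) ((\<lambda>z. \<mu> * z) ` \<Lambda>))) =
    card (jordan_index \<Lambda> d)"
  unfolding jordan_index_scale[OF assms]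
  by (rule card_image) (use assms in \<open>auto intro!: inj_onI\<close>)

lemma scaled_data_valid:
  fixes \<mu> :: complex
  assumes "\<mu> \<noteq> 0" "d \<in> \<Lambda> \<rightarrow>\<^sub>E partitions" "m = restrict (\<lambda>z. \<Phi> (d z)) \<Lambda>"
  defines "M \<equiv> (\<lambda>z. \<mu> * z) ` \<Lambda>"
  shows "restrict (\<lambda>\<nu>. d (\<nu> / \<mu>)) M \<in> M \<rightarrow>\<^sub>E partitions"
    "restrict (\<lambda>\<nu>. m (\<nu> / \<mu>)) M = restrict (\<lambda>z. \<Phi> (restrict (\<lambda>\<nu>. d (\<nu> / \<mu>)) M z)) M"
  using assms(1-3) by (auto simp: M_def PiE_iff restrict_def fun_eq_iff extensional_def)

text \<open>
The image of a Jordan chain under \<open>\<psi>\<close> becomes a Jordan chain for \<open>\<mu>\<close> times the eigenvalue once its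
\<open>j\<close>-th vector is divided by \<open>\<mu>\<^sup>j\<close>.
\<close>

lemma jordan_data_transport:
  fixes A A' \<psi> :: "complex^'n \<Rightarrow> complex^'n"
  assumes A': "clinear A'" and \<psi>: "clinear \<psi>" and q: "vec.subspace q" and inj: "inj_on \<psi> q"
    and q': "\<psi> ` q = q'" and \<mu>: "\<mu> \<noteq> 0"
    and com: "\<And>x. x \<in> q \<Longrightarrow> A' (\<psi> x) = \<mu> *s \<psi> (A x)" and t: "jordan_data A q t"
  shows "jordan_data A' q' (scale_jdata \<mu> t)"
proof -
  obtain \<Lambda> m d where tt: "t = (\<Lambda>, m, d)" by (metis prod_cases3)
  obtain e where d: "d \<in> \<Lambda> \<rightarrow>\<^sub>E partitions" "m = restrict (\<lambda>z. \<Phi> (d z)) \<Lambda>" and e: "jordan_basis A q \<Lambda> d e"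
    using t tt jordan_data_iff by metis
  let ?M = "(\<lambda>z. \<mu> * z) ` \<Lambda>"
  let ?d = "restrict (\<lambda>\<nu>. d (\<nu> / \<mu>)) ?M"
  define e' where "e' = (\<lambda>(\<nu>, i, j). (1 / \<mu>) ^ j *s \<psi> (e (\<nu> / \<mu>, i, j)))"
  let ?I = "jordan_index ?M ?d"
  have qs: "vec.span (e ` jordan_index \<Lambda> d) = q" using e by (simp add: jordan_basis_def)
  have eq: "e x \<in> q" if "x \<in> jordan_index \<Lambda> d" for x
    using qs that by (metis imageI vec.span_base)
  have q's: "vec.subspace q'" using q' \<psi> q vec.linear_subspace_image by blast
  have fin: "finite ?I" unfolding jordan_index_scale[OF \<mu>] using jordan_basis_finite[OF e] by simp
  have "card ?I = vec.dim q"
    using jordan_basis_card[OF e] by (simp only: card_jordan_index_scale[OF \<mu>])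
  also have "\<dots> = vec.dim q'"
    using vec.dim_image_eq[OF \<psi>, of q] inj q' q by (metis vec.span_eq_iff)
  finally have card: "card ?I = vec.dim q'" .
  have e'e: "e' (\<mu> * z, i, j) = (1 / \<mu>) ^ j *s \<psi> (e (z, i, j))" for z i j
    using \<mu> by (simp add: e'_def)
  have sub: "e' ` ?I \<subseteq> q'"
  proof (clarsimp simp: jordan_index_scale[OF \<mu>] e'e)
    fix z i j assume "(z, i, j) \<in> jordan_index \<Lambda> d"
    then have "\<psi> (e (z,i,j)) \<in> q'" using eq q' by blast
    then show "(1 / \<mu>) ^ j *s \<psi> (e (z, i, j)) \<in> q'" by (rule vec.subspace_scale[OF q's])
  qed
  have "\<psi> (e (z,i,j)) \<in> vec.span (e' ` ?I)" if "(z,i,j) \<in> jordan_index \<Lambda> d" for z i j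
  proof -
    have "(\<mu> * z, i, j) \<in> ?I" using that by (force simp: jordan_index_scale[OF \<mu>])
    moreover have "\<psi> (e (z,i,j)) = \<mu> ^ j *s e' (\<mu> * z, i, j)"
      using \<mu> by (simp add: e'e power_one_over)
    ultimately show ?thesis by (metis imageI vec.span_base vec.span_scale)
  qed
  then have "vec.span (\<psi> ` e ` jordan_index \<Lambda> d) \<subseteq> vec.span (e' ` ?I)"
    by (intro vec.span_minimal) auto
  then have cov: "q' \<subseteq> vec.span (e' ` ?I)"
    using qs q' by (simp add: vec.linear_span_image[OF \<psi>])
  note fam = spanning_family[OF fin q's sub cov]
  have "jordan_basis A' q' ?M ?d e'"
    unfolding jordan_basis_def
  proof (intro conjI allI impI)
    fix \<nu> i j assume "(\<nu>, i, j) \<in> ?I"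
    then obtain z where z: "\<nu> = \<mu> * z" "(z, i, j) \<in> jordan_index \<Lambda> d"
      by (auto simp: jordan_index_scale[OF \<mu>])
    have "A (e (z,i,j)) = z *s e (z,i,j) + (if j = 0 then 0 else e (z, i, j - 1))"
      using e z by (simp add: jordan_basis_def)
    then have "A' (\<psi> (e (z,i,j))) = (\<mu> * z) *s \<psi> (e (z,i,j)) + (if j = 0 then 0 else \<mu> *s \<psi> (e (z, i, j - 1)))"
      using com[OF eq[OF z(2)]] by (simp add: clinear_simps[OF \<psi>] vector_add_ldistrib)
    then show "A' (e' (\<nu>, i, j)) = \<nu> *s e' (\<nu>, i, j) + (if j = 0 then 0 else e' (\<nu>, i, j - 1))"
      using \<mu> by (cases j) (simp_all add: z e'e clinear_simps[OF A'] vector_add_ldistrib mult.commute)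
  qed (use fam card in auto)
  then show ?thesis
    using scaled_data_valid[OF \<mu> d] by (simp only: tt scale_jdata.simps jordan_data_iff) blast
qed

section \<open>Double extensions as skew-symmetric operators\<close>

definition hyp_compl :: "complex^'n \<Rightarrow> complex^'n \<Rightarrow> (complex^'n) set" where
  "hyp_compl x y = {Z. x \<bullet>\<^sub>c Z = 0 \<and> y \<bullet>\<^sub>c Z = 0}"

definition hyp_proj :: "complex^'n \<Rightarrow> complex^'n \<Rightarrow> complex^'n \<Rightarrow> complex^'n" where
  "hyp_proj x y Z = Z - (y \<bullet>\<^sub>c Z) *s x - (x \<bullet>\<^sub>c Z) *s y"

text \<open>
The double extension bracket written on the whole space: the coefficients along \<open>y\<close> are the
products with \<open>x\<close>.
\<close>

definition ext_bracket :: "(complex^'n \<Rightarrow> complex^'n) \<Rightarrow> complex^'n \<Rightarrow> complex^'n \<Rightarrow> complex^'n \<Rightarrow> complex^'n" where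
  "ext_bracket A x Z W = (x \<bullet>\<^sub>c Z) *s A W - (x \<bullet>\<^sub>c W) *s A Z + (A Z \<bullet>\<^sub>c W) *s x"

locale skew_extension =
  fixes A :: "complex^'n \<Rightarrow> complex^'n" and x y :: "complex^'n"
  assumes lin: "clinear A" and skew: "A Z \<bullet>\<^sub>c W = - (Z \<bullet>\<^sub>c A W)"
    and Ax: "A x = 0" and Ay: "A y = 0"
    and xx: "x \<bullet>\<^sub>c x = 0" and yy: "y \<bullet>\<^sub>c y = 0" and xy: "x \<bullet>\<^sub>c y = 1"
begin

abbreviation "q \<equiv> hyp_compl x y"
abbreviation "\<pi> \<equiv> hyp_proj x y"
abbreviation "br \<equiv> ext_bracket A x"

lemma yx: "y \<bullet>\<^sub>c x = 1" using xy by (simp add: sp_commute)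

lemma xA: "x \<bullet>\<^sub>c A Z = 0" using skew[of x Z] Ax by simp
lemma yA: "y \<bullet>\<^sub>c A Z = 0" using skew[of y Z] Ay by simp
lemma Ax': "A Z \<bullet>\<^sub>c x = 0" using xA sp_commute by metis
lemma Ay': "A Z \<bullet>\<^sub>c y = 0" using yA sp_commute by metis

lemma subspace_q: "vec.subspace q"
  by (rule vec.subspaceI) (auto simp: hyp_compl_def)

lemma A_mem: "A Z \<in> q" by (simp add: hyp_compl_def xA yA)

lemma proj_mem: "\<pi> Z \<in> q" by (simp add: hyp_compl_def hyp_proj_def xx yy xy yx)

lemma proj_id: "Z \<in> q \<Longrightarrow> \<pi> Z = Z" by (simp add: hyp_compl_def hyp_proj_def)

lemma A_proj: "A (\<pi> Z) = A Z" by (simp add: hyp_proj_def clinear_simps[OF lin] Ax Ay)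

lemma decomposition: "Z = \<pi> Z + (y \<bullet>\<^sub>c Z) *s x + (x \<bullet>\<^sub>c Z) *s y" by (simp add: hyp_proj_def)

lemma clinear_proj: "clinear \<pi>"
  unfolding hyp_proj_def[abs_def] by (intro clinear_intros)

lemma sp_proj: "W \<in> q \<Longrightarrow> W \<bullet>\<^sub>c \<pi> Z = W \<bullet>\<^sub>c Z"
  by (simp add: hyp_proj_def hyp_compl_def sp_commute[of W])

text \<open>
A basis of \<open>q\<close> together with \<open>x\<close> and \<open>y\<close> is a basis of the whole space.
\<close>

lemma dim_q: "vec.dim q + 2 = CARD('n)"
proof -
  obtain B where B: "B \<subseteq> q" "vec.independent B" "q \<subseteq> vec.span B" "card B = vec.dim q"
    using vec.basis_exists[of q] by blast
  have fin: "finite B" using B(2) vec.finiteI_independent by blast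
  have sB: "vec.span B = q" using B subspace_q by (simp add: subset_antisym vec.span_minimal)
  have xB: "x \<notin> vec.span B" using sB yx by (simp add: hyp_compl_def)
  have ker: "vec.subspace {Z. x \<bullet>\<^sub>c Z = 0}" by (rule vec.subspaceI) auto
  have "vec.span (insert x B) \<subseteq> {Z. x \<bullet>\<^sub>c Z = 0}"
    by (rule vec.span_minimal[OF _ ker]) (use B(1) xx in \<open>auto simp: hyp_compl_def\<close>)
  then have yB: "y \<notin> vec.span (insert x B)" using xy by auto
  have ind: "vec.independent (insert y (insert x B))"
    by (intro vec.independent_insertI yB xB B)
  have "UNIV \<subseteq> vec.span (insert y (insert x B))"
  proof
    fix Z
    let ?S = "vec.span (insert y (insert x B))"
    have "\<pi> Z \<in> ?S" using proj_mem sB vec.span_mono[of B "insert y (insert x B)"] by blast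
    moreover have "x \<in> ?S" "y \<in> ?S" by (auto intro: vec.span_base)
    ultimately show "Z \<in> ?S"
      by (subst decomposition) (intro vec.span_add vec.span_scale)
  qed
  then have "card (insert y (insert x B)) = CARD('n)"
    using vec.basis_card_eq_dim[OF subset_UNIV _ ind] by (simp only: vec_dim_card)
  moreover have "x \<notin> B" "y \<notin> insert x B" using xB yB vec.span_base by blast+
  ultimately show ?thesis using fin B(4) by simp
qed

lemma bracket_y: "br y Z = A Z"
  by (simp add: ext_bracket_def xy Ay)

lemma lie: "lie_bracket br"
proof -
  have "clinear (br Z)" for Z
    by (rule clinearI) (simp_all add: ext_bracket_def clinear_simps[OF lin] vec_eq_iff algebra_simps)
  moreover have "clinear (\<lambda>Z. br Z W)" for W
    by (rule clinearI) (simp_all add: ext_bracket_def clinear_simps[OF lin] vec_eq_iff algebra_simps)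
  moreover have "br Z Z = 0" for Z
    using skew[of Z Z] sp_commute[of Z "A Z"] by (simp add: ext_bracket_def)
  moreover have "br X (br Y Z) + br Y (br Z X) + br Z (br X Y) = 0" for X Y Z
    using sp_commute[of "A X" "A Y"] sp_commute[of "A X" "A Z"] sp_commute[of "A Y" "A Z"]
    by (simp add: ext_bracket_def clinear_simps[OF lin] xx xA Ax Ax' vec_eq_iff algebra_simps)
  ultimately show ?thesis by (simp add: lie_bracket_def)
qed

lemma quadratic: "quadratic_structure br"
proof -
  have "br X Y \<bullet>\<^sub>c Z = X \<bullet>\<^sub>c br Y Z" for X Y Z
    using skew[of X Y] skew[of X Z] by (simp add: ext_bracket_def sp_commute[of X x])
  then show ?thesis using lie by (simp add: quadratic_structure_def)
qed

lemma double_extension: "double_extension br x y q"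
  unfolding double_extension_def
proof (intro conjI ballI allI)
  fix Z show "\<exists>X\<in>q. \<exists>a b. Z = X + a *s x + b *s y"
    using decomposition[of Z] proj_mem by blast
next
  fix X Y a b a' b' assume "X \<in> q" "Y \<in> q"
  then have "x \<bullet>\<^sub>c X = 0" "x \<bullet>\<^sub>c Y = 0" by (auto simp: hyp_compl_def)
  then show "br (X + a *s x + b *s y) (Y + a' *s x + b' *s y) =
      b *s br y Y - b' *s br y X + (br y X \<bullet>\<^sub>c Y) *s x"
    by (simp add: bracket_y) (simp add: ext_bracket_def xx xy clinear_simps[OF lin] Ax Ay Ax' Ay')
next
  fix X Y assume "X \<in> q" "Y \<in> q"
  show "br y X \<bullet>\<^sub>c Y = - (X \<bullet>\<^sub>c br y Y)" by (simp add: bracket_y skew)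
next
  fix X show "br y X \<in> q" by (simp add: bracket_y A_mem)
qed (use subspace_q in \<open>auto simp: xx yy xy hyp_compl_def\<close>)

text \<open>
The freedom in the choice of the hyperbolic pair that produces the action of \<open>\<complex>\<^sup>*\<close>.
\<close>

lemma scaled:
  assumes "\<mu> \<noteq> 0"
  shows "skew_extension (\<lambda>Z. \<mu> *s A Z) ((1 / \<mu>) *s x) (\<mu> *s y)"
    "ext_bracket (\<lambda>Z. \<mu> *s A Z) ((1 / \<mu>) *s x) = br"
    "hyp_compl ((1 / \<mu>) *s x) (\<mu> *s y) = q"
proof -
  show "skew_extension (\<lambda>Z. \<mu> *s A Z) ((1 / \<mu>) *s x) (\<mu> *s y)"
    by (rule skew_extension.intro) (use assms in \<open>simp_all add: clinear_intros lin skew clinear_simps[OF lin] Ax Ay xx yy xy\<close>)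
qed (use assms in \<open>auto simp: ext_bracket_def hyp_compl_def fun_eq_iff\<close>)

end

text \<open>
Conversely every decomposition has this form. Evaluating the bracket formula at \<open>Y0\<close> and \<open>X0\<close> shows that
\<open>ad Y0\<close> kills \<open>X0\<close>; everything else follows by splitting vectors into components.
\<close>

lemma double_extension_skew_extension:
  assumes lie: "lie_bracket br" and D: "double_extension br X0 Y0 q"
  shows "skew_extension (br Y0) X0 Y0" "br = ext_bracket (br Y0) X0" "q = hyp_compl X0 Y0"
proof -
  note D' = D[unfolded double_extension_def]
  have xx: "X0 \<bullet>\<^sub>c X0 = 0" and yy: "Y0 \<bullet>\<^sub>c Y0 = 0" and xy: "X0 \<bullet>\<^sub>c Y0 = 1"
    and q: "vec.subspace q" and orth: "\<And>X. X \<in> q \<Longrightarrow> X0 \<bullet>\<^sub>c X = 0 \<and> Y0 \<bullet>\<^sub>c X = 0"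
    and dec: "\<And>Z. \<exists>X\<in>q. \<exists>a b. Z = X + a *s X0 + b *s Y0"
    and inv: "\<And>X. X \<in> q \<Longrightarrow> br Y0 X \<in> q"
    and skew: "\<And>X Y. X \<in> q \<Longrightarrow> Y \<in> q \<Longrightarrow> br Y0 X \<bullet>\<^sub>c Y = - (X \<bullet>\<^sub>c br Y0 Y)"
    and br: "\<And>X Y a b a' b'. X \<in> q \<Longrightarrow> Y \<in> q \<Longrightarrow> br (X + a *s X0 + b *s Y0) (Y + a' *s X0 + b' *s Y0) =
          b *s br Y0 Y - b' *s br Y0 X + (br Y0 X \<bullet>\<^sub>c Y) *s X0"
    using D' by blast+
  have yx: "Y0 \<bullet>\<^sub>c X0 = 1" using xy by (simp add: sp_commute)
  have lin: "clinear (br Y0)" using lie by (simp add: lie_bracket_def)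
  have q0: "0 \<in> q" using q by (rule vec.subspace_0)
  have Ax: "br Y0 X0 = 0" using br[OF q0 q0, of 0 1 1 0] by (simp add: clinear_simps[OF lin])
  have Ay: "br Y0 Y0 = 0" using lie by (simp add: lie_bracket_def)
  have A: "br Y0 (X + a *s X0 + b *s Y0) = br Y0 X" for X a b
    by (simp add: clinear_simps[OF lin] Ax Ay)
  have orth': "X \<bullet>\<^sub>c X0 = 0" "X \<bullet>\<^sub>c Y0 = 0" if "X \<in> q" for X
    using orth[OF that] by (simp_all add: sp_commute)
  show "skew_extension (br Y0) X0 Y0"
  proof (rule skew_extension.intro)
    fix Z W
    obtain X a b where Z: "X \<in> q" "Z = X + a *s X0 + b *s Y0" using dec by blast
    obtain Y a' b' where W: "Y \<in> q" "W = Y + a' *s X0 + b' *s Y0" using dec by blast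
    show "br Y0 Z \<bullet>\<^sub>c W = - (Z \<bullet>\<^sub>c br Y0 W)"
      unfolding Z(2) W(2) A using skew[OF Z(1) W(1)] orth[OF inv[OF W(1)]] orth'[OF inv[OF Z(1)]] by simp
  qed (fact lin Ax Ay xx yy xy)+
  show "br = ext_bracket (br Y0) X0"
  proof (intro ext)
    fix Z W
    obtain X a b where Z: "X \<in> q" "Z = X + a *s X0 + b *s Y0" using dec by blast
    obtain Y a' b' where W: "Y \<in> q" "W = Y + a' *s X0 + b' *s Y0" using dec by blast
    have "X0 \<bullet>\<^sub>c Z = b" "X0 \<bullet>\<^sub>c W = b'" "br Y0 X \<bullet>\<^sub>c W = br Y0 X \<bullet>\<^sub>c Y"
      using orth[OF Z(1)] orth[OF W(1)] orth'[OF inv[OF Z(1)]] by (simp_all add: Z(2) W(2) xx xy)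
    moreover have "br Y0 Z = br Y0 X" "br Y0 W = br Y0 Y" by (simp_all only: Z(2) W(2) A)
    moreover have "br Z W = b *s br Y0 Y - b' *s br Y0 X + (br Y0 X \<bullet>\<^sub>c Y) *s X0"
      unfolding Z(2) W(2) by (rule br[OF Z(1) W(1)])
    ultimately show "br Z W = ext_bracket (br Y0) X0 Z W"
      by (simp only: ext_bracket_def)
  qed
  show "q = hyp_compl X0 Y0"
  proof
    show "q \<subseteq> hyp_compl X0 Y0" using orth by (auto simp: hyp_compl_def)
    show "hyp_compl X0 Y0 \<subseteq> q"
    proof
      fix Z assume Z: "Z \<in> hyp_compl X0 Y0"
      obtain X a b where X: "X \<in> q" "Z = X + a *s X0 + b *s Y0" using dec by blast
      have "b = 0" "a = 0" using Z orth[OF X(1)] by (auto simp: X(2) hyp_compl_def xx xy yx yy)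
      then show "Z \<in> q" using X by simp
    qed
  qed
qed

section \<open>Isomorphic brackets have proportional Jordan data\<close>

locale invertible_extension = skew_extension +
  assumes inj_q: "Z \<in> q \<Longrightarrow> A Z = 0 \<Longrightarrow> Z = 0" and q_nontrivial: "q \<noteq> {0}"
begin

text \<open>
Bracketing a central element with \<open>y\<close> shows that its \<open>q\<close>-component is killed by \<open>A\<close>, and bracketing with a
nonzero element of \<open>q\<close> shows that it has no \<open>y\<close>-component.
\<close>

lemma center:
  assumes "\<And>W. br Z W = 0"
  shows "Z = (y \<bullet>\<^sub>c Z) *s x"
proof -
  have "A Z = 0" using assms[of y] by (simp add: ext_bracket_def xy Ay Ay')
  then have pz: "\<pi> Z = 0" using inj_q[OF proj_mem] A_proj by simp
  obtain W where W: "W \<in> q" "W \<noteq> 0" using q_nontrivial subspace_q vec.subspace_0 by blast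
  then have "A W \<noteq> 0" using inj_q by blast
  moreover have "(x \<bullet>\<^sub>c Z) *s A W = 0" using assms[of W] W \<open>A Z = 0\<close> by (simp add: ext_bracket_def)
  ultimately have "x \<bullet>\<^sub>c Z = 0" by simp
  then show ?thesis using decomposition[of Z] pz by simp
qed

lemma x_central: "br x W = 0" by (simp add: ext_bracket_def xx Ax)

lemma x_nonzero: "x \<noteq> 0" using xy by auto

lemma inj_on_q: "inj_on A q"
proof (rule inj_onI)
  fix Z W assume "Z \<in> q" "W \<in> q" "A Z = A W"
  then have "Z - W \<in> q" "A (Z - W) = 0"
    using subspace_q by (auto simp: vec.subspace_diff clinear_simps[OF lin])
  then show "Z = W" using inj_q by fastforce
qed

lemma image_q: "A ` q = q"
proof -
  have "A ` q \<subseteq> q" using A_mem by blast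
  moreover have "inj_on A (vec.span q)"
    using inj_on_q subspace_q by (simp add: vec.span_eq_iff[THEN iffD2])
  then have "vec.dim (A ` q) = vec.dim q" by (rule vec.dim_image_eq[OF lin])
  ultimately show ?thesis
    using vec.subspace_dim_equal[of "A ` q" q] subspace_q vec.linear_subspace_image[OF lin] by simp
qed

lemma bij_q: "bij_betw A q q"
  using inj_on_q image_q by (simp add: bij_betw_def)

end

text \<open>
Invertibility does not depend on the decomposition: an element of the second \<open>q\<close> killed by the second
operator is central, hence a multiple of the isotropic vector \<open>x'\<close>, whose line meets the second \<open>q\<close> only in \<open>0\<close>.
\<close>

lemma invertible_extension_other_decomposition:
  assumes "invertible_extension A x y" "skew_extension A' x' y'" "ext_bracket A x = ext_bracket A' x'"
  shows "invertible_extension A' x' y'"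
proof -
  interpret L: invertible_extension A x y by fact
  interpret L': skew_extension A' x' y' by fact
  have x': "x' = (y \<bullet>\<^sub>c x') *s x"
    by (rule L.center) (simp add: assms(3) ext_bracket_def L'.xx L'.Ax)
  have c: "y \<bullet>\<^sub>c x' \<noteq> 0" using x' L'.xy by force
  show ?thesis
  proof
    fix Z assume Z: "Z \<in> hyp_compl x' y'" "A' Z = 0"
    have "Z = (y \<bullet>\<^sub>c Z) *s x"
      by (rule L.center) (use Z in \<open>simp add: assms(3) ext_bracket_def hyp_compl_def\<close>)
    moreover have "x = (1 / (y \<bullet>\<^sub>c x')) *s x'" by (subst (2) x') (use c in simp)
    ultimately obtain k where k: "Z = k *s x'" by (metis vector_smult_assoc)
    then have "k = 0" using Z L'.yx by (auto simp: hyp_compl_def)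
    then show "Z = 0" using k by simp
  next
    have "vec.dim (hyp_compl x' y') = vec.dim (hyp_compl x y)" using L.dim_q L'.dim_q by simp
    moreover have "vec.dim (hyp_compl x y) \<noteq> 0"
      using L.q_nontrivial L.subspace_q vec.subspace_0 by auto
    ultimately have "vec.dim (hyp_compl x' y') \<noteq> 0" by linarith
    then show "hyp_compl x' y' \<noteq> {0}" by (metis vec.dim_eq_0 order_refl)
  qed
qed

text \<open>
A Lie isomorphism \<open>\<phi>\<close> maps the centre \<open>\<complex> x\<close> to the centre \<open>\<complex> x'\<close> and maps \<open>q = A q\<close>, which consists of
brackets with \<open>y\<close>, into brackets, that is, into vectors orthogonal to \<open>x'\<close>. Projecting to the second
\<open>q\<close> gives a bijection \<open>\<psi>\<close>, and applying \<open>\<phi>\<close> to \<open>A Z = [y, Z]\<close> gives \<open>\<psi> A = \<beta> A' \<psi>\<close>, where \<open>\<beta>\<close> is the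
\<open>y'\<close>-component of \<open>\<phi> y\<close>.
\<close>

lemma isomorphism_scales_jordan_data:
  assumes "invertible_extension A x y" "invertible_extension A' x' y'"
    and iso: "isomorphic_brackets (ext_bracket A x) (ext_bracket A' x')"
    and t: "jordan_data A (hyp_compl x y) t"
  shows "\<exists>\<mu>. \<mu> \<noteq> 0 \<and> jordan_data A' (hyp_compl x' y') (scale_jdata \<mu> t)"
proof -
  interpret L: invertible_extension A x y by fact
  interpret L': invertible_extension A' x' y' by fact
  obtain \<phi> where \<phi>: "clinear \<phi>" and bij: "bij \<phi>" and hom: "\<And>X Y. \<phi> (L.br X Y) = L'.br (\<phi> X) (\<phi> Y)"
    using iso unfolding isomorphic_brackets_def by blast
  note \<phi>s = clinear_simps[OF \<phi>]
  define c where "c = y' \<bullet>\<^sub>c \<phi> x"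
  have \<phi>x: "\<phi> x = c *s x'"
    unfolding c_def
  proof (rule L'.center)
    fix W
    obtain V where "W = \<phi> V" using bij by (metis bij_pointE)
    then have "L'.br (\<phi> x) W = \<phi> (L.br x V)" by (simp only: hom)
    then show "L'.br (\<phi> x) W = 0" by (simp only: L.x_central \<phi>s)
  qed
  have \<phi>0: "Z = 0" if "\<phi> Z = 0" for Z using that bij \<phi>s(3) by (metis bij_is_inj injD)
  have c0: "c \<noteq> 0"
  proof
    assume "c = 0"
    then have "\<phi> x = 0" using \<phi>x by simp
    then have "x = 0" by (rule \<phi>0)
    then show False using L.x_nonzero by simp
  qed
  define \<beta> where "\<beta> = x' \<bullet>\<^sub>c \<phi> y"
  define \<psi> where "\<psi> Z = L'.\<pi> (\<phi> Z)" for Z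
  have \<psi>: "clinear \<psi>" unfolding \<psi>_def by (intro clinear_comp[OF L'.clinear_proj] \<phi>)
  note \<psi>s = clinear_simps[OF \<psi>]
  have x'q: "x' \<bullet>\<^sub>c \<phi> Z = 0" if "Z \<in> L.q" for Z
  proof -
    have "Z \<in> A ` L.q" using that L.image_q by simp
    then obtain Z' where "Z = A Z'" by (rule imageE)
    then have "\<phi> Z = L'.br (\<phi> y) (\<phi> Z')" by (simp only: hom[symmetric] L.bracket_y)
    then show ?thesis by (simp add: ext_bracket_def L'.xx L'.xA)
  qed
  have com: "\<psi> (A Z) = \<beta> *s A' (\<psi> Z)" if "Z \<in> L.q" for Z
  proof -
    have "\<phi> (A Z) = L'.br (\<phi> y) (\<phi> Z)" by (simp only: hom[symmetric] L.bracket_y)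
    also have "\<dots> = \<beta> *s A' (\<phi> Z) + (A' (\<phi> y) \<bullet>\<^sub>c \<phi> Z) *s x'"
      by (simp add: ext_bracket_def \<beta>_def x'q[OF that])
    finally have eq: "\<phi> (A Z) = \<beta> *s A' (\<phi> Z) + (A' (\<phi> y) \<bullet>\<^sub>c \<phi> Z) *s x'" .
    have "L'.\<pi> x' = 0" by (simp add: hyp_proj_def L'.xx L'.yx)
    then show ?thesis
      unfolding \<psi>_def eq by (simp add: clinear_simps[OF L'.clinear_proj] L'.proj_id[OF L'.A_mem] L'.A_proj)
  qed
  have \<psi>0: "Z = 0" if "Z \<in> L.q" "\<psi> Z = 0" for Z
  proof -
    define k where "k = (y' \<bullet>\<^sub>c \<phi> Z) / c"
    have "\<phi> Z = (y' \<bullet>\<^sub>c \<phi> Z) *s x'"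
      using L'.decomposition[of "\<phi> Z"] that x'q[OF that(1)] by (simp add: \<psi>_def)
    also have "\<dots> = k *s \<phi> x" using c0 by (simp add: \<phi>x k_def)
    finally have "\<phi> (Z - k *s x) = 0" by (simp add: \<phi>s)
    then have "Z - k *s x = 0" by (rule \<phi>0)
    then have Z: "Z = k *s x" by simp
    then have "k = 0" using that(1) L.yx by (auto simp: hyp_compl_def)
    then show ?thesis using Z by simp
  qed
  have inj: "inj_on \<psi> L.q"
  proof (rule inj_onI)
    fix Z W assume "Z \<in> L.q" "W \<in> L.q" "\<psi> Z = \<psi> W"
    then have "Z - W \<in> L.q" "\<psi> (Z - W) = 0"
      using L.subspace_q by (auto simp: vec.subspace_diff \<psi>s)
    then have "Z - W = 0" by (rule \<psi>0)
    then show "Z = W" by simp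
  qed
  have im: "\<psi> ` L.q = L'.q"
  proof -
    have "\<psi> ` L.q \<subseteq> L'.q" using L'.proj_mem by (auto simp: \<psi>_def)
    moreover have "vec.dim (\<psi> ` L.q) = vec.dim L.q"
      using inj L.subspace_q by (intro vec.dim_image_eq[OF \<psi>]) (simp add: vec.span_eq_iff[THEN iffD2])
    moreover have "vec.dim L.q = vec.dim L'.q" using L.dim_q L'.dim_q by simp
    ultimately show ?thesis
      using vec.subspace_dim_equal[of "\<psi> ` L.q" L'.q] L.subspace_q L'.subspace_q
        vec.linear_subspace_image[OF \<psi>] by simp
  qed
  have b0: "\<beta> \<noteq> 0"
  proof
    assume "\<beta> = 0"
    obtain W where W: "W \<in> L.q" "W \<noteq> 0" using L.q_nontrivial L.subspace_q vec.subspace_0 by blast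
    then have "\<psi> (A W) = 0" using com[OF W(1)] \<open>\<beta> = 0\<close> by simp
    then have "A W = 0" by (rule \<psi>0[OF L.A_mem])
    then show False using W L.inj_q[OF W(1)] by simp
  qed
  have "jordan_data A' L'.q (scale_jdata (1 / \<beta>) t)"
  proof (rule jordan_data_transport[OF L'.lin \<psi> L.subspace_q inj im _ _ t])
    show "1 / \<beta> \<noteq> 0" using b0 by simp
    fix Z assume "Z \<in> L.q"
    then show "A' (\<psi> Z) = (1 / \<beta>) *s \<psi> (A Z)" using b0 by (simp add: com[OF \<open>Z \<in> L.q\<close>])
  qed
  then show ?thesis using b0 by (metis divide_eq_0_iff one_neq_zero)
qed

section \<open>Symmetry of the Jordan data under negation\<close>

context skew_extension
begin

lemma eq_0I: "\<pi> Z = 0 \<Longrightarrow> x \<bullet>\<^sub>c Z = 0 \<Longrightarrow> y \<bullet>\<^sub>c Z = 0 \<Longrightarrow> Z = 0"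
  using decomposition[of Z] by simp

text \<open>
The form is nondegenerate on \<open>q\<close>, so a vector of \<open>q\<close> is determined by its products with a spanning set.
\<close>

lemma q_eqI:
  assumes "u \<in> q" "v \<in> q" "q \<subseteq> vec.span E" "\<And>w. w \<in> E \<Longrightarrow> w \<bullet>\<^sub>c u = w \<bullet>\<^sub>c v"
  shows "u = v"
proof -
  have sub: "vec.subspace {w. w \<bullet>\<^sub>c (u - v) = 0}" by (rule vec.subspaceI) (auto simp: algebra_simps)
  have "vec.span E \<subseteq> {w. w \<bullet>\<^sub>c (u - v) = 0}"
    by (rule vec.span_minimal[OF _ sub]) (use assms(4) in auto)
  then have 0: "w \<bullet>\<^sub>c (u - v) = 0" if "w \<in> q" for w using that assms(3) by auto
  have uv: "u - v \<in> q" using assms subspace_q by (simp add: vec.subspace_diff)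
  have "u - v = 0"
  proof (rule sp_nondegenerate)
    fix w
    have "(u - v) \<bullet>\<^sub>c w = (u - v) \<bullet>\<^sub>c \<pi> w" using sp_proj[OF uv] by simp
    also have "\<dots> = \<pi> w \<bullet>\<^sub>c (u - v)" by (rule sp_commute)
    also have "\<dots> = 0" by (rule 0[OF proj_mem])
    finally show "(u - v) \<bullet>\<^sub>c w = 0" .
  qed
  then show ?thesis by simp
qed

text \<open>
Extend the coordinate functionals to the whole space, represent them by vectors, and project to \<open>q\<close>,
which does not change the products with elements of \<open>q\<close>. The functionals are encoded
as linear maps into the line of a fixed coordinate vector.
\<close>

lemma dual_basis_exists:
  assumes inj: "inj_on e I" and ind: "vec.independent (e ` I)"
    and sub: "e ` I \<subseteq> q"
  shows "\<exists>f. \<forall>k\<in>I. f k \<in> q \<and> (\<forall>i\<in>I. e i \<bullet>\<^sub>c f k = (if i = k then 1 else 0))"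
proof -
  have "\<exists>F. F \<in> q \<and> (\<forall>i\<in>I. e i \<bullet>\<^sub>c F = (if i = k then 1 else 0))" for k
  proof -
    let ?a = "axis undefined 1 :: complex^'n"
    obtain h where h: "clinear h" "\<forall>v\<in>e ` I. h v = (if the_inv_into I e v = k then ?a else 0)"
      using vec.linear_independent_extend[OF ind, of "\<lambda>v. if the_inv_into I e v = k then ?a else 0"] by blast
    have "e i \<bullet>\<^sub>c \<pi> (sp_adjoint h ?a) = (if i = k then 1 else 0)" if "i \<in> I" for i
    proof -
      have "e i \<bullet>\<^sub>c \<pi> (sp_adjoint h ?a) = e i \<bullet>\<^sub>c sp_adjoint h ?a" using sub that by (intro sp_proj) auto
      also have "\<dots> = h (e i) \<bullet>\<^sub>c ?a" by (rule sp_adjoint[OF h(1)])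
      also have "h (e i) = (if i = k then ?a else 0)" using h(2) that the_inv_into_f_f[OF inj that] by simp
      finally show ?thesis by simp
    qed
    then show ?thesis using proj_mem by blast
  qed
  then show ?thesis by metis
qed

text \<open>
In the basis \<open>f\<close> dual to a Jordan basis, the skew operator \<open>A\<close> is minus the transpose:
\<open>A f\<^sub>j = - z f\<^sub>j - f\<^sub>j\<^sub>+\<^sub>1\<close> along a block for \<open>z\<close>. Reversing the order of the block and alternating the signs gives
a Jordan chain for \<open>-z\<close>.
\<close>

lemma jordan_data_uminus:
  assumes t: "jordan_data A q t"
  shows "jordan_data A q (scale_jdata (- 1) t)"
proof -
  obtain \<Lambda> m d where tt: "t = (\<Lambda>, m, d)" by (metis prod_cases3)
  obtain e where d: "d \<in> \<Lambda> \<rightarrow>\<^sub>E partitions" "m = restrict (\<lambda>z. \<Phi> (d z)) \<Lambda>" and e: "jordan_basis A q \<Lambda> d e"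
    using t tt jordan_data_iff by metis
  let ?I = "jordan_index \<Lambda> d"
  have inj: "inj_on e ?I" and ind: "vec.independent (e ` ?I)" and sp: "vec.span (e ` ?I) = q"
    and ch: "\<And>z i j. (z, i, j) \<in> ?I \<Longrightarrow> A (e (z, i, j)) = z *s e (z, i, j) + (if j = 0 then 0 else e (z, i, j - 1))"
    using e unfolding jordan_basis_def by blast+
  have "e ` ?I \<subseteq> q" unfolding sp[symmetric] by (rule vec.span_superset)
  from dual_basis_exists[OF inj ind this] obtain f where f: "\<forall>k\<in>?I. f k \<in> q \<and> (\<forall>i\<in>?I. e i \<bullet>\<^sub>c f k = (if i = k then 1 else 0))"
    by (rule exE)
  have fq: "f k \<in> q" and ef: "i \<in> ?I \<Longrightarrow> e i \<bullet>\<^sub>c f k = (if i = k then 1 else 0)" if "k \<in> ?I" for k i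
    using f that by simp_all
  have Af: "A (f (z,i,j)) = (- z) *s f (z,i,j) - (if Suc j < d z ! i then f (z,i,Suc j) else 0)"
    if I: "(z,i,j) \<in> ?I" for z i j
  proof (rule q_eqI)
    show "q \<subseteq> vec.span (e ` ?I)" using sp by simp
    show "A (f (z,i,j)) \<in> q" by (rule A_mem)
    have S: "(z,i,Suc j) \<in> ?I" if "Suc j < d z ! i" using that I by (simp add: jordan_index_def)
    then have "(if Suc j < d z ! i then f (z,i,Suc j) else 0) \<in> q"
      using fq[OF S] vec.subspace_0[OF subspace_q] by simp
    then show "(- z) *s f (z,i,j) - (if Suc j < d z ! i then f (z,i,Suc j) else 0) \<in> q"
      by (intro vec.subspace_diff vec.subspace_scale subspace_q fq I)
    fix w assume "w \<in> e ` ?I"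
    then obtain z' i' j' where w: "w = e (z',i',j')" and I': "(z',i',j') \<in> ?I" by auto
    have p: "(z',i',j'-1) \<in> ?I" using I' by (auto simp: jordan_index_def)
    have "w \<bullet>\<^sub>c A (f (z,i,j)) = - (A w \<bullet>\<^sub>c f (z,i,j))" using skew[of w "f (z,i,j)"] by simp
    also have "\<dots> = - (z' * (if (z',i',j') = (z,i,j) then 1 else 0) + (if j' \<noteq> 0 \<and> (z',i',j'-1) = (z,i,j) then 1 else 0))"
      using ef[OF I I'] ef[OF I p] unfolding w ch[OF I'] by auto
    also have "\<dots> = - z * (if (z',i',j') = (z,i,j) then 1 else 0) - (if (z',i',j') = (z,i,Suc j) then 1 else 0)"
      by auto
    also have "(if (z',i',j') = (z,i,Suc j) then 1 else 0) = w \<bullet>\<^sub>c (if Suc j < d z ! i then f (z,i,Suc j) else 0)"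
    proof (cases "Suc j < d z ! i")
      case True then show ?thesis using ef[OF S[OF True] I'] by (simp add: w)
    next
      case False
      then have "(z',i',j') \<noteq> (z,i,Suc j)" using I' by (auto simp: jordan_index_def)
      then show ?thesis using False by auto
    qed
    finally show "w \<bullet>\<^sub>c A (f (z,i,j)) = w \<bullet>\<^sub>c ((- z) *s f (z,i,j) - (if Suc j < d z ! i then f (z,i,Suc j) else 0))"
      using ef[OF I I'] by (simp add: w)
  qed
  define M where "M = (\<lambda>z. - 1 * z) ` \<Lambda>"
  define D where "D = restrict (\<lambda>\<nu>. d (\<nu> / - 1)) M"
  define e' where "e' = (\<lambda>(w,i,j). (-1) ^ j *s f (-w, i, d (-w) ! i - 1 - j))"
  define g' where "g' = (\<lambda>(w,i,j). (-1) ^ j *s e (-w, i, d (-w) ! i - 1 - j))"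
  have I': "jordan_index M D = (\<lambda>(z, i, j). (- 1 * z, i, j)) ` ?I"
    unfolding M_def D_def by (rule jordan_index_scale) simp
  have memI: "(w,i,j) \<in> jordan_index M D \<Longrightarrow> (-w,i,j) \<in> ?I" for w i j
    unfolding I' by auto
  have memR: "(-w,i,d (-w) ! i - 1 - j) \<in> ?I" if "(w,i,j) \<in> jordan_index M D" for w i j
    using memI[OF that] by (auto simp: jordan_index_def)
  have fin: "finite (jordan_index M D)" unfolding I' using jordan_basis_finite[OF e] by simp
  have dual: "e' k \<bullet>\<^sub>c g' l = (if k = l then 1 else 0)"
    if kl: "k \<in> jordan_index M D" "l \<in> jordan_index M D" for k l
  proof -
    obtain w i j w' i' j' where k: "k = (w,i,j)" "l = (w',i',j')" by (metis prod_cases3)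
    have "e' k \<bullet>\<^sub>c g' l = (-1) ^ j * ((-1) ^ j' * (e (-w',i',d (-w') ! i' - 1 - j') \<bullet>\<^sub>c f (-w,i,d (-w) ! i - 1 - j)))"
      by (simp add: e'_def g'_def k sp_commute)
    also have "\<dots> = (-1) ^ j * ((-1) ^ j' * (if k = l then 1 else 0))"
    proof -
      have "j < d (-w) ! i" "j' < d (-w') ! i'" using memI kl by (auto simp: k jordan_index_def)
      then have "(-w',i',d (-w') ! i' - 1 - j') = (-w,i,d (-w) ! i - 1 - j) \<longleftrightarrow> k = l" by (auto simp: k)
      then show ?thesis using ef[OF memR memR, of w i j w' i' j'] kl by (simp add: k)
    qed
    also have "\<dots> = (if k = l then 1 else 0)" by (auto simp: k simp flip: power_mult_distrib)
    finally show ?thesis .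
  qed
  note fam = dual_family_independent[OF fin dual]
  have sub: "e' ` jordan_index M D \<subseteq> q"
  proof (clarify)
    fix w i j assume "(w,i,j) \<in> jordan_index M D"
    then show "e' (w,i,j) \<in> q" using fq[OF memR] subspace_q by (simp add: e'_def vec.subspace_scale)
  qed
  have card: "card (jordan_index M D) = vec.dim q"
    using jordan_basis_card[OF e] card_jordan_index_scale[of "-1" \<Lambda> d] unfolding M_def D_def by simp
  have "jordan_basis A q M D e'"
    unfolding jordan_basis_def
  proof (intro conjI allI impI)
    show "vec.span (e' ` jordan_index M D) = q"
      by (rule independent_family_spans[OF fin subspace_q sub fam card])
    fix w i j assume I: "(w,i,j) \<in> jordan_index M D"
    have j: "j < d (-w) ! i" using memI[OF I] by (simp add: jordan_index_def)
    show "A (e' (w,i,j)) = w *s e' (w,i,j) + (if j = 0 then 0 else e' (w,i,j-1))"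
    proof (cases j)
      case 0
      then show ?thesis using Af[OF memR[OF I]] j by (simp add: e'_def)
    next
      case (Suc j')
      define k where "k = d (-w) ! i - 1 - j"
      have k: "Suc k < d (-w) ! i" "Suc k = d (-w) ! i - 1 - j'" using j Suc by (auto simp: k_def)
      have "A (f (-w,i,k)) = w *s f (-w,i,k) - f (-w,i,Suc k)"
        using Af[OF memR[OF I], folded k_def] k(1) by simp
      moreover have ej: "e' (w,i,j) = (-1) ^ j *s f (-w,i,k)" by (simp add: e'_def k_def)
      ultimately have "A (e' (w,i,j)) = (-1) ^ j *s (w *s f (-w,i,k) - f (-w,i,Suc k))"
        by (simp only: clinear_simps[OF lin])
      moreover have "e' (w,i,j-1) = (-1) ^ j' *s f (-w,i,Suc k)" by (simp add: e'_def k(2) Suc)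
      ultimately show ?thesis unfolding ej using Suc
        by (simp add: vec_eq_iff algebra_simps)
    qed
  qed (use fam in auto)
  then show ?thesis
    using scaled_data_valid[of "-1", OF _ d] unfolding tt scale_jdata.simps jordan_data_iff M_def D_def
    by (metis neg_equal_0_iff_equal one_neq_zero)
qed

end

lemma (in invertible_extension) jordan_data_in_J:
  assumes n: "CARD('a) = 2 * p + 2" and t: "jordan_data A q t"
  shows "t \<in> J p"
proof -
  obtain \<Lambda> m d where tt: "t = (\<Lambda>, m, d)" by (metis prod_cases3)
  obtain e where d: "d \<in> \<Lambda> \<rightarrow>\<^sub>E partitions" "m = restrict (\<lambda>z. \<Phi> (d z)) \<Lambda>" and e: "jordan_basis A q \<Lambda> d e"
    using t tt jordan_data_iff by metis
  have dp: "d z \<in> partitions" if "z \<in> \<Lambda>" for z using d that by auto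
  have fin: "finite \<Lambda>" by (rule jordan_basis_spectrum_finite[OF e dp])
  have sum: "(\<Sum>z\<in>\<Lambda>. m z) = 2 * p"
    using card_jordan_index[OF fin, of d] jordan_basis_card[OF e] dim_q n by (simp add: d(2))
  have m1: "m z \<ge> 1" if "z \<in> \<Lambda>" for z
    using dp[OF that] that by (cases "d z") (auto simp: d(2) partitions_def \<Phi>_def)
  have "card \<Lambda> = (\<Sum>z\<in>\<Lambda>. 1)" by simp
  also have "\<dots> \<le> (\<Sum>z\<in>\<Lambda>. m z)" by (rule sum_mono) (use m1 in auto)
  finally have card: "card \<Lambda> \<le> 2 * p" using sum by simp
  have z0: "0 \<notin> \<Lambda>"
  proof
    assume "0 \<in> \<Lambda>"
    then have I: "(0,0,0) \<in> jordan_index \<Lambda> d"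
      using partitions_nonempty[OF dp] by (simp add: jordan_index_def)
    have "e (0,0,0) \<in> q" using e I unfolding jordan_basis_def by (metis imageI vec.span_base)
    moreover have "A (e (0,0,0)) = 0" using e I unfolding jordan_basis_def by simp
    ultimately have "e (0,0,0) = 0" by (rule inj_q)
    then have "0 \<in> e ` jordan_index \<Lambda> d" using I by (metis imageI)
    then show False using e vec.dependent_zero unfolding jordan_basis_def by metis
  qed
  have "t = scale_jdata (-1) t" by (rule jordan_data_unique[OF lin t jordan_data_uminus[OF t]])
  then have C: "\<Lambda> = (\<lambda>z. - 1 * z) ` \<Lambda> \<and> m = restrict (\<lambda>\<nu>. m (\<nu> / - 1)) ((\<lambda>z. - 1 * z) ` \<Lambda>) \<and>
      d = restrict (\<lambda>\<nu>. d (\<nu> / - 1)) ((\<lambda>z. - 1 * z) ` \<Lambda>)"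
    unfolding tt scale_jdata.simps prod.inject .
  note L = C[THEN conjunct1] and ms = C[THEN conjunct2, THEN conjunct1] and ds = C[THEN conjunct2, THEN conjunct2]
  have sym: "- z \<in> \<Lambda>" if "z \<in> \<Lambda>" for z
  proof -
    have "- 1 * z \<in> (\<lambda>z. - 1 * z) ` \<Lambda>" using that by (rule imageI)
    then show ?thesis unfolding L[symmetric] by simp
  qed
  have ms': "m z = m (- z)" if "z \<in> \<Lambda>" for z
    using that fun_cong[OF ms, of z] unfolding L[symmetric] by simp
  have ds': "d z = d (- z)" if "z \<in> \<Lambda>" for z
    using that fun_cong[OF ds, of z] unfolding L[symmetric] by simp
  have "(\<forall>z. z \<in> \<Lambda> \<longleftrightarrow> - z \<in> \<Lambda>)" using sym by (metis minus_minus)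
  moreover have "m \<in> \<Lambda> \<rightarrow>\<^sub>E {1..}" using m1 d(2) by auto
  moreover have "\<Lambda> \<subseteq> - {0}" using z0 by auto
  moreover have "\<forall>z\<in>\<Lambda>. \<Phi> (d z) = m z" using d(2) by simp
  ultimately show ?thesis
    unfolding J_def tt using fin card sum d(1) ms' ds' by blast
qed

section \<open>Similar skew-symmetric operators are isometric\<close>

text \<open>
\<open>R = r(S)\<close>, where \<open>r\<^sup>2\<close> is congruent to the indeterminate modulo a polynomial annihilating \<open>S\<close>. As a
polynomial in \<open>S\<close> it is symmetric and commutes with everything that commutes with \<open>S\<close>.
\<close>

lemma symmetric_square_root:
  fixes S :: "complex^'n \<Rightarrow> complex^'n"
  assumes S: "clinear S" and sym: "\<And>u v. S u \<bullet>\<^sub>c v = u \<bullet>\<^sub>c S v" and inj: "\<And>u. S u = 0 \<Longrightarrow> u = 0"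
  shows "\<exists>R. clinear R \<and> bij R \<and> (\<forall>u. R (R u) = S u) \<and> (\<forall>u v. R u \<bullet>\<^sub>c v = u \<bullet>\<^sub>c R v) \<and>
    (\<forall>B. clinear B \<longrightarrow> (\<forall>u. S (B u) = B (S u)) \<longrightarrow> (\<forall>u. R (B u) = B (R u)))"
proof -
  obtain f where f: "poly f 0 \<noteq> 0" "\<And>u. poly_endo S f u = 0" using annihilating_poly_inj[OF S inj] by blast
  obtain r k where "r * r - [:0,1:] = f * k" using poly_sqrt_mod[OF f(1)] by (auto elim: dvdE)
  then have r: "r * r = k * f + [:0,1:]" by (simp add: algebra_simps)
  let ?R = "poly_endo S r"
  have R: "clinear ?R" by (rule clinear_poly_endo[OF S])
  have RR: "?R (?R u) = S u" for u
  proof -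
    have "?R (?R u) = poly_endo S (k * f + [:0,1:]) u" unfolding r[symmetric] by (simp only: poly_endo_mult[OF S])
    also have "\<dots> = S u"
      by (simp add: poly_endo_add[OF S] poly_endo_mult[OF S] f(2) clinear_simps[OF clinear_poly_endo[OF S]] poly_endo_pCons[OF S] clinear_simps[OF S])
    finally show ?thesis .
  qed
  have "inj ?R"
  proof (rule injI)
    fix u v assume "?R u = ?R v"
    then have "S (u - v) = 0" by (simp add: RR[symmetric] clinear_simps[OF R])
    then have "u - v = 0" by (rule inj)
    then show "u = v" by simp
  qed
  then have "bij ?R" using vec.linear_inj_imp_surj[OF R] by (simp add: bij_def)
  then show ?thesis
    using R RR poly_endo_adjoint[OF S sym] poly_endo_commute[OF S] by blast
qed

text \<open>
The polar decomposition argument: \<open>S = \<phi>\<^sup>T \<phi>\<close> commutes with \<open>A\<close> because both operators are skew-symmetric,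
and \<open>\<phi> R\<^sup>-\<^sup>1\<close> is an isometry if \<open>R\<close> is a symmetric square root of \<open>S\<close>.
\<close>

lemma similar_skew_isometric:
  fixes A A' \<phi> :: "complex^'n \<Rightarrow> complex^'n"
  assumes A: "clinear A" "\<And>u v. A u \<bullet>\<^sub>c v = - (u \<bullet>\<^sub>c A v)"
    and A': "clinear A'" "\<And>u v. A' u \<bullet>\<^sub>c v = - (u \<bullet>\<^sub>c A' v)"
    and \<phi>: "clinear \<phi>" "bij \<phi>" and com: "\<And>u. \<phi> (A u) = A' (\<phi> u)"
  shows "\<exists>Q. clinear Q \<and> (\<forall>u v. Q u \<bullet>\<^sub>c Q v = u \<bullet>\<^sub>c v) \<and> (\<forall>u. Q (A u) = A' (Q u))"
proof -
  define S where "S u = sp_adjoint \<phi> (\<phi> u)" for u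
  have S: "clinear S" unfolding S_def by (intro clinear_comp[OF clinear_sp_adjoint] \<phi>)
  have S1: "S u \<bullet>\<^sub>c v = \<phi> u \<bullet>\<^sub>c \<phi> v" for u v by (simp add: S_def sp_adjoint_left[OF \<phi>(1)])
  have S2: "u \<bullet>\<^sub>c S v = \<phi> u \<bullet>\<^sub>c \<phi> v" for u v by (simp add: S_def sp_adjoint[OF \<phi>(1)])
  have inj: "u = 0" if "S u = 0" for u
  proof -
    have "\<phi> u = 0"
    proof (rule sp_nondegenerate)
      fix w
      obtain v where "w = \<phi> v" using \<phi>(2) by (metis bij_pointE)
      then show "\<phi> u \<bullet>\<^sub>c w = 0" using S1[of u v] that by simp
    qed
    then show ?thesis using \<phi> clinear_simps(3)[OF \<phi>(1)] by (metis bij_is_inj injD)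
  qed
  have SA: "S (A u) = A (S u)" for u
  proof (rule sp_eqI)
    fix v
    have "S (A u) \<bullet>\<^sub>c v = - (\<phi> u \<bullet>\<^sub>c \<phi> (A v))" by (simp add: S1 com A'(2))
    also have "\<dots> = A (S u) \<bullet>\<^sub>c v" by (simp add: S1[symmetric] A(2))
    finally show "S (A u) \<bullet>\<^sub>c v = A (S u) \<bullet>\<^sub>c v" .
  qed
  obtain R where R: "clinear R" "bij R" "\<And>u. R (R u) = S u" "\<And>u v. R u \<bullet>\<^sub>c v = u \<bullet>\<^sub>c R v"
    and RA: "\<And>u. R (A u) = A (R u)"
    using symmetric_square_root[OF S _ inj] S1 S2 SA A(1) by metis
  let ?Ri = "inv R"
  have Ri: "R (?Ri u) = u" "?Ri (R u) = u" for u
    using R(2) by (simp_all add: bij_is_surj surj_f_inv_f bij_is_inj inv_f_f)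
  have linRi: "clinear ?Ri" using vec.inj_linear_imp_inv_linear[OF R(1)] R(2) by (simp add: bij_is_inj)
  have ARi: "?Ri (A u) = A (?Ri u)" for u
    by (metis RA Ri)
  define Q where "Q u = \<phi> (?Ri u)" for u
  have "clinear Q" unfolding Q_def by (intro clinear_comp[OF \<phi>(1)] linRi)
  moreover have "Q u \<bullet>\<^sub>c Q v = u \<bullet>\<^sub>c v" for u v
  proof -
    have "Q u \<bullet>\<^sub>c Q v = S (?Ri u) \<bullet>\<^sub>c ?Ri v" by (simp add: Q_def S1)
    also have "\<dots> = R (R (?Ri u)) \<bullet>\<^sub>c ?Ri v" by (simp only: R(3))
    also have "\<dots> = u \<bullet>\<^sub>c R (?Ri v)" by (simp only: Ri R(4))
    finally show ?thesis by (simp only: Ri)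
  qed
  moreover have "Q (A u) = A' (Q u)" for u by (simp add: Q_def ARi com)
  ultimately show ?thesis by blast
qed

lemma same_jordan_data_similar:
  fixes A A' :: "complex^'n \<Rightarrow> complex^'n"
  assumes "skew_extension A x y" "skew_extension A' x' y'"
    and t: "jordan_data A (hyp_compl x y) t" "jordan_data A' (hyp_compl x' y') t"
  shows "\<exists>\<phi>. clinear \<phi> \<and> bij \<phi> \<and> (\<forall>u. \<phi> (A u) = A' (\<phi> u))"
proof -
  interpret L: skew_extension A x y by fact
  interpret L': skew_extension A' x' y' by fact
  obtain \<Lambda> m d where tt: "t = (\<Lambda>, m, d)" by (metis prod_cases3)
  obtain e where e: "jordan_basis A L.q \<Lambda> d e" using t tt jordan_data_iff by metis
  obtain e' where e': "jordan_basis A' L'.q \<Lambda> d e'" using t tt jordan_data_iff by metis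
  let ?I = "jordan_index \<Lambda> d"
  have inj: "inj_on e ?I" and ind: "vec.independent (e ` ?I)" and sp: "vec.span (e ` ?I) = L.q"
    and ch: "\<And>z i j. (z, i, j) \<in> ?I \<Longrightarrow> A (e (z, i, j)) = z *s e (z, i, j) + (if j = 0 then 0 else e (z, i, j - 1))"
    using e unfolding jordan_basis_def by blast+
  have sp': "vec.span (e' ` ?I) = L'.q"
    and ch': "\<And>z i j. (z, i, j) \<in> ?I \<Longrightarrow> A' (e' (z, i, j)) = z *s e' (z, i, j) + (if j = 0 then 0 else e' (z, i, j - 1))"
    using e' unfolding jordan_basis_def by blast+
  obtain g where g: "clinear g" "\<forall>v\<in>e ` ?I. g v = e' (the_inv_into ?I e v)"
    using vec.linear_independent_extend[OF ind, of "\<lambda>v. e' (the_inv_into ?I e v)"] by blast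
  have ge: "g (e k) = e' k" if "k \<in> ?I" for k using g(2) that the_inv_into_f_f[OF inj that] by simp
  note gs = clinear_simps[OF g(1)]
  have gA: "g (A w) = A' (g w)" if "w \<in> L.q" for w
  proof (rule vec.linear_eq_on[of "\<lambda>w. g (A w)" "\<lambda>w. A' (g w)" w "e ` ?I"])
    show "clinear (\<lambda>w. g (A w))" "clinear (\<lambda>w. A' (g w))"
      by (fact clinear_comp[OF g(1) L.lin] clinear_comp[OF L'.lin g(1)])+
    show "w \<in> vec.span (e ` ?I)" using that sp by simp
    fix b assume "b \<in> e ` ?I"
    then obtain z i j where b: "b = e (z,i,j)" and I: "(z,i,j) \<in> ?I" by auto
    have p: "(z,i,j-1) \<in> ?I" using I by (auto simp: jordan_index_def)
    show "g (A b) = A' (g b)" unfolding b ge[OF I] ch[OF I] ch'[OF I] using ge[OF p] by (simp add: gs ge[OF I])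
  qed
  have gq: "g ` L.q = L'.q"
  proof -
    have "g ` e ` ?I = e' ` ?I" unfolding image_image by (rule image_cong[OF refl ge])
    then show ?thesis using sp sp' vec.linear_span_image[OF g(1), of "e ` ?I"] by simp
  qed
  define \<phi> where "\<phi> Z = g (L.\<pi> Z) + (y \<bullet>\<^sub>c Z) *s x' + (x \<bullet>\<^sub>c Z) *s y'" for Z
  have \<phi>: "clinear \<phi>" unfolding \<phi>_def by (intro clinear_intros clinear_comp[OF g(1)] L.clinear_proj)
  have "\<exists>Z. W = \<phi> Z" for W
  proof -
    have "L'.\<pi> W \<in> g ` L.q" using L'.proj_mem gq by simp
    then obtain w where w: "w \<in> L.q" "g w = L'.\<pi> W" by (metis imageE)
    let ?Z = "w + (y' \<bullet>\<^sub>c W) *s x + (x' \<bullet>\<^sub>c W) *s y"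
    have "x \<bullet>\<^sub>c w = 0" "y \<bullet>\<^sub>c w = 0" using w by (auto simp: hyp_compl_def)
    then have 1: "x \<bullet>\<^sub>c ?Z = x' \<bullet>\<^sub>c W" "y \<bullet>\<^sub>c ?Z = y' \<bullet>\<^sub>c W" by (simp_all add: L.xx L.xy L.yx L.yy)
    then have "L.\<pi> ?Z = w" unfolding hyp_proj_def by simp
    then have "\<phi> ?Z = W" using L'.decomposition[of W] unfolding \<phi>_def 1 w(2)[symmetric] by simp
    then show ?thesis by metis
  qed
  then have "surj \<phi>" by (metis surjI)
  then have "bij \<phi>" using vec.linear_surj_imp_inj[OF \<phi>] by (simp add: bij_def)
  moreover have "\<phi> (A Z) = A' (\<phi> Z)" for Z
  proof -
    have "\<phi> (A Z) = g (A Z)" by (simp add: \<phi>_def L.proj_id[OF L.A_mem] L.xA L.yA)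
    also have "\<dots> = g (A (L.\<pi> Z))" by (simp only: L.A_proj)
    also have "\<dots> = A' (g (L.\<pi> Z))" by (rule gA[OF L.proj_mem])
    also have "\<dots> = A' (\<phi> Z)" by (simp add: \<phi>_def clinear_simps[OF L'.lin] L'.Ax L'.Ay)
    finally show ?thesis .
  qed
  ultimately show ?thesis using \<phi> by blast
qed

text \<open>
The intertwining isometry \<open>Q\<close> maps \<open>q = A q\<close> into the second \<open>q\<close>, so it extends by \<open>x \<mapsto> x'\<close>, \<open>y \<mapsto> y'\<close> to a map that
respects all ingredients of the bracket.
\<close>

lemma same_jordan_data_isomorphic:
  fixes A A' :: "complex^'n \<Rightarrow> complex^'n"
  assumes "invertible_extension A x y" "invertible_extension A' x' y'"
    and t: "jordan_data A (hyp_compl x y) t" "jordan_data A' (hyp_compl x' y') t"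
  shows "isomorphic_brackets (ext_bracket A x) (ext_bracket A' x')"
proof -
  interpret L: invertible_extension A x y by fact
  interpret L': invertible_extension A' x' y' by fact
  obtain \<phi> where "clinear \<phi>" "bij \<phi>" "\<And>u. \<phi> (A u) = A' (\<phi> u)"
    using same_jordan_data_similar[OF L.skew_extension_axioms L'.skew_extension_axioms t] by blast
  then obtain Q where Q: "clinear Q" and iso: "\<And>u v. Q u \<bullet>\<^sub>c Q v = u \<bullet>\<^sub>c v" and QA: "\<And>u. Q (A u) = A' (Q u)"
    using similar_skew_isometric[OF L.lin L.skew L'.lin L'.skew] by blast
  note Qs = clinear_simps[OF Q]
  have Qq: "Q w \<in> L'.q" if "w \<in> L.q" for w
  proof -
    have "w \<in> A ` L.q" using that L.image_q by simp
    then obtain v where "w = A v" by (rule imageE)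
    then show ?thesis by (simp add: QA L'.A_mem)
  qed
  define \<Psi> where "\<Psi> Z = Q (L.\<pi> Z) + (y \<bullet>\<^sub>c Z) *s x' + (x \<bullet>\<^sub>c Z) *s y'" for Z
  have \<Psi>: "clinear \<Psi>" unfolding \<Psi>_def by (intro clinear_intros clinear_comp[OF Q] L.clinear_proj)
  have Qpi: "x' \<bullet>\<^sub>c Q (L.\<pi> Z) = 0" "y' \<bullet>\<^sub>c Q (L.\<pi> Z) = 0" for Z
    using Qq[OF L.proj_mem[of Z]] by (auto simp: hyp_compl_def)
  have x\<Psi>: "x' \<bullet>\<^sub>c \<Psi> Z = x \<bullet>\<^sub>c Z" and y\<Psi>: "y' \<bullet>\<^sub>c \<Psi> Z = y \<bullet>\<^sub>c Z" for Z
    by (simp_all add: \<Psi>_def Qpi L'.xx L'.xy L'.yx L'.yy)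
  have \<Psi>A: "\<Psi> (A Z) = Q (A Z)" for Z
    by (simp add: \<Psi>_def L.proj_id[OF L.A_mem] L.xA L.yA)
  have A\<Psi>: "A' (\<Psi> Z) = Q (A Z)" for Z
  proof -
    have "A' (\<Psi> Z) = A' (Q (L.\<pi> Z))" by (simp add: \<Psi>_def clinear_simps[OF L'.lin] L'.Ax L'.Ay)
    also have "\<dots> = Q (A Z)" by (simp only: QA[symmetric] L.A_proj)
    finally show ?thesis .
  qed
  have \<Psi>x: "\<Psi> x = x'"
  proof -
    have "L.\<pi> x = 0" by (simp add: hyp_proj_def L.xx L.yx)
    then show ?thesis by (simp add: \<Psi>_def L.xx L.yx Qs)
  qed
  have pair: "Q (A Z) \<bullet>\<^sub>c \<Psi> W = A Z \<bullet>\<^sub>c W" for Z W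
  proof -
    have "Q (A Z) \<bullet>\<^sub>c x' = 0" "Q (A Z) \<bullet>\<^sub>c y' = 0" by (simp_all only: QA L'.Ax' L'.Ay')
    then have "Q (A Z) \<bullet>\<^sub>c \<Psi> W = Q (A Z) \<bullet>\<^sub>c Q (L.\<pi> W)" by (simp add: \<Psi>_def)
    also have "\<dots> = A Z \<bullet>\<^sub>c W" by (simp only: iso L.sp_proj[OF L.A_mem])
    finally show ?thesis .
  qed
  have hom: "\<Psi> (L.br Z W) = L'.br (\<Psi> Z) (\<Psi> W)" for Z W
    by (simp add: ext_bracket_def clinear_simps[OF \<Psi>] x\<Psi> A\<Psi> \<Psi>A \<Psi>x pair)
  have "inj \<Psi>"
  proof (rule injI)
    fix Z W assume "\<Psi> Z = \<Psi> W"
    then have 0: "\<Psi> (Z - W) = 0" by (simp add: clinear_simps[OF \<Psi>])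
    then have xy: "x \<bullet>\<^sub>c (Z - W) = 0" "y \<bullet>\<^sub>c (Z - W) = 0" using x\<Psi>[of "Z - W"] y\<Psi>[of "Z - W"] by (simp_all only: 0 sp_simps(10))
    then have "Q (L.\<pi> (Z - W)) = 0" using 0 by (simp only: \<Psi>_def) simp
    then have "L.\<pi> (Z - W) \<bullet>\<^sub>c v = 0" for v using iso[of "L.\<pi> (Z - W)" v] by simp
    then have "L.\<pi> (Z - W) = 0" by (rule sp_nondegenerate)
    then have "Z - W = 0" using xy by (rule L.eq_0I)
    then show "Z = W" by simp
  qed
  then have "bij \<Psi>" using vec.linear_inj_imp_surj[OF \<Psi>] by (simp add: bij_def)
  then show ?thesis unfolding isomorphic_brackets_def using \<Psi> hom by blast
qed

section \<open>Invertible double extensions are singular and solvable\<close>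

lemma (in skew_extension) invertible_if_spectrum_nonzero:
  assumes t: "jordan_data A q (\<Lambda>, m, d)" and 0: "0 \<notin> \<Lambda>" and q: "q \<noteq> {0}"
  shows "invertible_extension A x y"
proof
  fix Z assume Z: "Z \<in> q" "A Z = 0"
  obtain e where e: "jordan_basis A q \<Lambda> d e" using t jordan_data_iff by metis
  have "{(z', i, j) \<in> jordan_index \<Lambda> d. z' \<noteq> 0 \<or> j + 1 < d z' ! i} = jordan_index \<Lambda> d"
    using 0 by (auto simp: jordan_index_def)
  then have "vec.dim (((\<lambda>x. A x - 0 *s x) ^^ 1) ` q) = vec.dim q"
    unfolding rank_from_jordan_basis[OF lin e] using jordan_basis_card[OF e] by simp
  then have dim: "vec.dim (A ` q) = vec.dim q" by simp
  show "Z = 0"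
  proof (rule ccontr)
    assume "Z \<noteq> 0"
    then have "vec.dim (A ` q) + card {Z} \<le> vec.dim q"
      using Z by (intro dim_image_kernel_le[OF lin subspace_q]) auto
    then show False using dim by simp
  qed
qed (fact q)

lemma sum_fun_apply: "(\<Sum>i\<in>I. f i) x = (\<Sum>i\<in>I. f i x)" for f :: "'i \<Rightarrow> 'v \<Rightarrow> complex"
  by (induction I rule: infinite_finite_induct) auto

text \<open>
The dimension is that of a subspace of the space of all functions, which is infinite-dimensional; it is only
meaningful because the coordinate functions span a finite-dimensional space containing all linear forms.
\<close>

lemma dup_pos:
  fixes br :: "'n::finite bracket" and \<alpha> :: "complex^'n \<Rightarrow> complex"
  assumes lin: "Vector_Spaces.linear (*s) (*) \<alpha>" and w: "\<And>X Y Z W. wedge_1_3 \<alpha> (three_form br) X Y Z W = 0"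
    and nz: "\<alpha> y \<noteq> 0"
  shows "dup br \<ge> 1"
proof -
  interpret F: vector_space "\<lambda>(c::complex) (\<alpha> :: complex^'n \<Rightarrow> complex). (\<lambda>X. c * \<alpha> X)"
    by unfold_locales (auto simp: fun_eq_iff algebra_simps)
  define D where "D = {\<alpha>. Vector_Spaces.linear (*s) (*) \<alpha> \<and>
         (\<forall>X Y Z W. wedge_1_3 \<alpha> (three_form br) X Y Z W = 0)}"
  define B where "B = range (\<lambda>i (X :: complex^'n). X $ i)"
  have span: "D \<subseteq> F.span B"
  proof
    fix \<gamma> assume "\<gamma> \<in> D"
    then have l: "Vector_Spaces.linear (*s) (*) \<gamma>" by (simp add: D_def)
    interpret l: Vector_Spaces.linear "(*s)" "(*)" \<gamma> by (fact l)
    have "\<gamma> X = (\<Sum>i\<in>UNIV. (\<lambda>X. \<gamma> (axis i 1) * X $ i)) X" for X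
    proof -
      have "\<gamma> X = \<gamma> (\<Sum>i\<in>UNIV. X $ i *s axis i 1)" by (simp add: basis_expansion)
      also have "\<dots> = (\<Sum>i\<in>UNIV. X $ i * \<gamma> (axis i 1))" by (simp only: l.sum l.scale)
      finally show ?thesis by (simp add: sum_fun_apply mult.commute)
    qed
    then have "\<gamma> = (\<Sum>i\<in>UNIV. (\<lambda>X. \<gamma> (axis i 1) * X $ i))" by (rule ext)
    also have "\<dots> \<in> F.span B"
      by (intro F.span_sum F.span_scale F.span_base) (simp add: B_def)
    finally show "\<gamma> \<in> F.span B" .
  qed
  obtain C where C: "C \<subseteq> D" "F.independent C" "D \<subseteq> F.span C" "card C = F.dim D"
    by (rule F.basis_exists)
  have "finite B" by (simp add: B_def)
  then have "finite C \<and> card C \<le> card B"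
    by (rule F.independent_span_bound[OF _ C(2) subset_trans[OF C(1) span]])
  moreover have "C \<noteq> {}"
  proof
    assume "C = {}"
    moreover have "\<alpha> \<in> D" using lin w by (simp add: D_def)
    ultimately have "\<alpha> = 0" using C(3) by auto
    then show False using nz by simp
  qed
  ultimately have "card C \<ge> 1" by (simp add: Suc_le_eq card_gt_0_iff)
  then show ?thesis unfolding dup_def C(4) D_def .
qed

context invertible_extension
begin

lemma solvable: "solvable_bracket br"
proof -
  have k1: "vec.subspace {Z. x \<bullet>\<^sub>c Z = 0}" by (rule vec.subspaceI) auto
  have d1: "derived_ideal br (Suc 0) \<subseteq> {Z. x \<bullet>\<^sub>c Z = 0}"
    unfolding derived_ideal.simps
    by (rule vec.span_minimal[OF _ k1]) (auto simp: ext_bracket_def xx xA)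
  have "br X Y \<in> vec.span {x}" if "x \<bullet>\<^sub>c X = 0" "x \<bullet>\<^sub>c Y = 0" for X Y
    using that by (simp add: ext_bracket_def vec.span_scale vec.span_base)
  then have d2: "derived_ideal br (Suc (Suc 0)) \<subseteq> vec.span {x}"
    unfolding derived_ideal.simps(2)[of br "Suc 0"] using d1
    by (intro vec.span_minimal vec.subspace_span) auto
  have "br X Y = 0" if "X \<in> vec.span {x}" "Y \<in> vec.span {x}" for X Y
    using that by (auto simp: vec.span_singleton ext_bracket_def xx clinear_simps[OF lin] Ax)
  then have "derived_ideal br (Suc (Suc (Suc 0))) \<subseteq> vec.span {0}"
    unfolding derived_ideal.simps(2)[of br "Suc (Suc 0)"] using d2
    by (intro vec.span_mono) auto
  moreover have "0 \<in> derived_ideal br (Suc (Suc (Suc 0)))"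
    unfolding derived_ideal.simps(2)[of br "Suc (Suc 0)"] by (rule vec.span_zero)
  ultimately have "derived_ideal br (Suc (Suc (Suc 0))) = {0}" by auto
  then show ?thesis unfolding solvable_bracket_def by blast
qed

text \<open>
The form \<open>\<alpha> = \<langle>x, -\<rangle>\<close> witnesses singularity: the three-form of the bracket is \<open>\<alpha> \<and> \<omega>\<close> with \<open>\<omega>(X,Y) = \<langle>A X,Y\<rangle>\<close>.
\<close>

lemma in_S_inv: "br \<in> S_inv"
proof -
  have "\<not> abelian_bracket br"
  proof
    assume "abelian_bracket br"
    then have "\<And>Z. A Z = 0" unfolding abelian_bracket_def by (simp add: bracket_y[symmetric])
    then have "q \<subseteq> {0}" using inj_q by auto
    then show False using q_nontrivial vec.subspace_0[OF subspace_q] by auto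
  qed
  moreover have "dup br \<ge> 1"
  proof (rule dup_pos)
    show "Vector_Spaces.linear (*s) (*) (\<lambda>Z. x \<bullet>\<^sub>c Z)"
      unfolding Vector_Spaces.linear_iff
      using vec.vector_space_axioms vector_space_over_itself.vector_space_axioms by simp
    show "x \<bullet>\<^sub>c y \<noteq> 0" using xy by simp
    show "wedge_1_3 (\<lambda>Z. x \<bullet>\<^sub>c Z) (three_form br) X Y Z W = 0" for X Y Z W
      by (simp add: wedge_1_3_def three_form_def ext_bracket_def algebra_simps)
  qed
  ultimately have "singular br" using quadratic by (simp add: singular_def)
  moreover have "bij_betw (br y) q q" using bij_q by (simp add: bracket_y[abs_def])
  ultimately show ?thesis
    using solvable double_extension unfolding S_inv_def invertible_singular_def by blast
qed

end

lemma S_inv_decomposition: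
  fixes br :: "'n::finite bracket"
  assumes S: "br \<in> S_inv" and D: "double_extension br X0 Y0 q"
  shows "invertible_extension (br Y0) X0 Y0" "br = ext_bracket (br Y0) X0" "q = hyp_compl X0 Y0"
proof -
  have lie: "lie_bracket br" and na: "\<not> abelian_bracket br"
    using S by (auto simp: S_inv_def invertible_singular_def singular_def quadratic_structure_def)
  note sk = double_extension_skew_extension[OF lie]
  show b: "br = ext_bracket (br Y0) X0" and "q = hyp_compl X0 Y0" by (fact sk(2,3)[OF D])+
  obtain X Y r where E: "double_extension br X Y r" "bij_betw (br Y) r r"
    using S by (auto simp: S_inv_def invertible_singular_def)
  have r: "r = hyp_compl X Y" by (rule sk(3)[OF E(1)])
  interpret E: skew_extension "br Y" X Y by (rule sk(1)[OF E(1)])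
  have "invertible_extension (br Y) X Y"
  proof
    fix Z assume Z: "Z \<in> E.q" "br Y Z = 0"
    have "inj_on (br Y) E.q" using E(2) r by (simp add: bij_betw_def)
    moreover have "0 \<in> E.q" by (rule vec.subspace_0[OF E.subspace_q])
    ultimately show "Z = 0" using Z clinear_simps(3)[OF E.lin] by (metis inj_onD)
  next
    show "E.q \<noteq> {0}"
    proof
      assume "E.q = {0}"
      then have "E.\<pi> Z = 0" for Z using E.proj_mem[of Z] by simp
      then have "br Y Z = 0" for Z using E.A_proj[of Z] clinear_simps(3)[OF E.lin] by simp
      then have "ext_bracket (br Y) X Z W = 0" for Z W by (simp add: ext_bracket_def)
      then have "br Z W = 0" for Z W using sk(2)[OF E(1)] by metis
      then show False using na by (simp add: abelian_bracket_def)
    qed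
  qed
  then show "invertible_extension (br Y0) X0 Y0"
    by (rule invertible_extension_other_decomposition[OF _ sk(1)[OF D]]) (use b sk(2)[OF E(1)] in metis)
qed

section \<open>Realization of all parameters\<close>

text \<open>
From orthonormal vectors \<open>\<epsilon>, \<epsilon>'\<close> one gets the hyperbolic pair \<open>\<epsilon> + \<i> \<epsilon>'\<close>, \<open>(\<epsilon> - \<i> \<epsilon>') / 2\<close>.
\<close>

lemma hyperbolic_family_exists:
  assumes fin: "finite K" and card: "2 * card K \<le> CARD('n::finite)"
  shows "\<exists>u v :: 'k \<Rightarrow> complex^'n. \<forall>k\<in>K. \<forall>l\<in>K.
    u k \<bullet>\<^sub>c u l = 0 \<and> v k \<bullet>\<^sub>c v l = 0 \<and> u k \<bullet>\<^sub>c v l = (if k = l then 1 else 0)"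
proof -
  have "card (K \<times> (UNIV :: bool set)) \<le> card (UNIV :: 'n set)"
    using card by (simp add: card_cartesian_product)
  then obtain h :: "'k \<times> bool \<Rightarrow> 'n" where h: "inj_on h (K \<times> UNIV)"
    using card_le_inj[of "K \<times> (UNIV :: bool set)" "UNIV :: 'n set"] fin by auto
  define E where "E k s = (axis (h (k, s)) 1 :: complex^'n)" for k s
  have E: "E k s \<bullet>\<^sub>c E l t = (if k = l \<and> s = t then 1 else 0)" if "k \<in> K" "l \<in> K" for k l s t
  proof -
    have "h (k, s) = h (l, t) \<longleftrightarrow> k = l \<and> s = t"
      using inj_on_eq_iff[OF h, of "(k, s)" "(l, t)"] that by simp
    moreover have "E k s \<bullet>\<^sub>c E l t = (axis (h (k, s)) 1 :: complex^'n) $ h (l, t)"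
      by (simp only: E_def sp_axis(1))
    ultimately show ?thesis by (auto simp: axis_def)
  qed
  define u where "u k = E k False + \<i> *s E k True" for k
  define v where "v k = (1 / 2) *s (E k False - \<i> *s E k True)" for k
  show ?thesis
    by (intro exI[of _ u] exI[of _ v]) (auto simp: u_def v_def E)
qed

definition elementary_skew :: "complex^'n \<Rightarrow> complex^'n \<Rightarrow> complex^'n \<Rightarrow> complex^'n" where
  "elementary_skew a b Z = (b \<bullet>\<^sub>c Z) *s a - (a \<bullet>\<^sub>c Z) *s b"

lemma clinear_elementary_skew: "clinear (elementary_skew a b)"
  unfolding elementary_skew_def[abs_def] by (intro clinear_intros)

lemma elementary_skew_skew: "elementary_skew a b Z \<bullet>\<^sub>c W = - (Z \<bullet>\<^sub>c elementary_skew a b W)"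
  by (simp add: elementary_skew_def sp_commute[of Z a] sp_commute[of Z b])

text \<open>
A choice of one element from each pair \<open>z, -z\<close> with \<open>z \<noteq> 0\<close>.
\<close>

definition half_plane :: "complex set" where
  "half_plane = {z. Re z > 0 \<or> (Re z = 0 \<and> Im z > 0)}"

lemma half_plane_uminus: "z \<noteq> 0 \<Longrightarrow> - z \<in> half_plane \<longleftrightarrow> z \<notin> half_plane"
  by (auto simp: half_plane_def complex_eq_iff)

text \<open>
Let \<open>P\<close> be the set of positions of the Jordan basis with eigenvalue in the half-plane; it has \<open>p\<close> elements.
Take hyperbolic pairs \<open>(U k, V k)\<close> for \<open>k \<in> P\<close> and one more pair \<open>(x, y)\<close>. Prescribing Jordan chains on the
vectors \<open>U k\<close> and requiring skew-symmetry forces minus the transposed action on the vectors \<open>V k\<close>. So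
the reversed vectors \<open>V k\<close> with alternating signs form the Jordan chains for the opposite eigenvalues.
\<close>

lemma jordan_data_realized:
  assumes card_n: "CARD('n::finite) = 2 * p + 2" and p: "p \<ge> 1" and t: "t \<in> J p"
  shows "\<exists>A x y. invertible_extension A x (y :: complex^'n) \<and> jordan_data A (hyp_compl x y) t"
proof -
  obtain \<Lambda> m d where tt: "t = (\<Lambda>, m, d)" by (metis prod_cases3)
  have C: "\<Lambda> \<subseteq> - {0} \<and> finite \<Lambda> \<and> card \<Lambda> \<le> 2 * p \<and> (\<forall>z. z \<in> \<Lambda> \<longleftrightarrow> - z \<in> \<Lambda>) \<and>
     m \<in> \<Lambda> \<rightarrow>\<^sub>E {1..} \<and> (\<forall>z\<in>\<Lambda>. m z = m (- z)) \<and> (\<Sum>z\<in>\<Lambda>. m z) = 2 * p \<and>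
     d \<in> \<Lambda> \<rightarrow>\<^sub>E partitions \<and> (\<forall>z\<in>\<Lambda>. d z = d (- z)) \<and> (\<forall>z\<in>\<Lambda>. \<Phi> (d z) = m z)"
    using t unfolding J_def tt mem_Collect_eq prod.case .
  have z0: "0 \<notin> \<Lambda>" and fin: "finite \<Lambda>" and sym: "\<And>z. z \<in> \<Lambda> \<Longrightarrow> - z \<in> \<Lambda>"
    and m: "m \<in> \<Lambda> \<rightarrow>\<^sub>E {1..}" and sum: "(\<Sum>z\<in>\<Lambda>. m z) = 2 * p"
    and d: "d \<in> \<Lambda> \<rightarrow>\<^sub>E partitions" and ds': "\<And>z. z \<in> \<Lambda> \<Longrightarrow> d z = d (- z)"
    and \<Phi>: "\<And>z. z \<in> \<Lambda> \<Longrightarrow> \<Phi> (d z) = m z"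
    using C by blast+
  have ds: "d (- z) = d z" if "z \<in> \<Lambda>" for z using ds'[OF that] by simp
  have hp: "- z \<in> half_plane \<longleftrightarrow> z \<notin> half_plane" if "z \<in> \<Lambda>" for z
    using that z0 by (intro half_plane_uminus) auto
  let ?I = "jordan_index \<Lambda> d"
  define P where "P = {(z,i,j) \<in> ?I. z \<in> half_plane}"
  have PI: "P \<subseteq> ?I" by (auto simp: P_def)
  have cI: "card ?I = 2 * p" using card_jordan_index[OF fin, of d] \<Phi> sum by simp
  have finI: "finite ?I" using cI p by (intro card_ge_0_finite) simp
  have finP: "finite P" unfolding P_def by (rule finite_subset[OF _ finI]) auto
  define n where "n = (\<lambda>(z,i,j). (- z, i, j) :: complex \<times> nat \<times> nat)"
  have inv: "n (n k) = k" for k by (simp add: n_def split_def)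
  have nI: "n k \<in> ?I" if "k \<in> ?I" for k
  proof -
    obtain z i j where k: "k = (z,i,j)" by (metis prod_cases3)
    then have "z \<in> \<Lambda>" using that by (simp add: jordan_index_def)
    then show ?thesis using that sym[of z] ds[of z] by (simp add: k n_def jordan_index_def)
  qed
  have nP: "n k \<in> P \<longleftrightarrow> k \<notin> P" if "k \<in> ?I" for k
  proof -
    obtain z i j where k: "k = (z,i,j)" by (metis prod_cases3)
    then have "z \<in> \<Lambda>" using that by (simp add: jordan_index_def)
    then show ?thesis using that nI[OF that] hp[of z] by (simp add: k n_def P_def)
  qed
  have "?I = P \<union> n ` P"
  proof
    show "P \<union> n ` P \<subseteq> ?I" using nI PI by auto
    show "?I \<subseteq> P \<union> n ` P"
    proof
      fix k assume k: "k \<in> ?I"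
      show "k \<in> P \<union> n ` P"
      proof (cases "k \<in> P")
        case False
        then have "n k \<in> P" using nP[OF k] by simp
        then have "n (n k) \<in> n ` P" by (rule imageI)
        then show ?thesis unfolding inv by simp
      qed simp
    qed
  qed
  moreover have "P \<inter> n ` P = {}"
  proof -
    have "n k \<notin> P" if "k \<in> P" for k using nP[OF subsetD[OF PI that]] that by simp
    then show ?thesis by blast
  qed
  moreover have "card (n ` P) = card P" by (rule card_image) (metis inj_onI inv)
  ultimately have cP: "card P = p" using cI finP card_Un_disjoint[of P "n ` P"] by simp
  \<comment> \<open>The index \<open>None\<close> is for the pair \<open>(x, y)\<close>.\<close>
  define K where "K = insert None (Some ` P)"
  have finK: "finite K" using finP by (simp add: K_def)
  have "card K = p + 1" using finP cP by (simp add: K_def card_image)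
  then have "2 * card K \<le> CARD('n)" using card_n by simp
  from hyperbolic_family_exists[OF finK this] obtain u v :: "(complex \<times> nat \<times> nat) option \<Rightarrow> complex^'n" where
    uv: "\<forall>k\<in>K. \<forall>l\<in>K. u k \<bullet>\<^sub>c u l = 0 \<and> v k \<bullet>\<^sub>c v l = 0 \<and> u k \<bullet>\<^sub>c v l = (if k = l then 1 else 0)"
    by (elim exE)
  define x where "x = u None"
  define y where "y = v None"
  define U where "U k = u (Some k)" for k
  define V where "V k = v (Some k)" for k
  have UV: "U k \<bullet>\<^sub>c U l = 0" "V k \<bullet>\<^sub>c V l = 0" "U k \<bullet>\<^sub>c V l = (if k = l then 1 else 0)"
    "V k \<bullet>\<^sub>c U l = (if k = l then 1 else 0)" if "k \<in> P" "l \<in> P" for k l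
    using uv that by (auto simp: U_def V_def K_def sp_commute[of "v _" "u _"])
  have xyP: "x \<bullet>\<^sub>c x = 0" "y \<bullet>\<^sub>c y = 0" "x \<bullet>\<^sub>c y = 1"
    "\<And>k. k \<in> P \<Longrightarrow> U k \<bullet>\<^sub>c x = 0" "\<And>k. k \<in> P \<Longrightarrow> U k \<bullet>\<^sub>c y = 0"
    "\<And>k. k \<in> P \<Longrightarrow> V k \<bullet>\<^sub>c x = 0" "\<And>k. k \<in> P \<Longrightarrow> V k \<bullet>\<^sub>c y = 0"
    using uv by (auto simp: U_def V_def K_def x_def y_def sp_commute[of "v (Some _)" "u None"])
  have xyP': "x \<bullet>\<^sub>c U k = 0" "y \<bullet>\<^sub>c U k = 0" "x \<bullet>\<^sub>c V k = 0" "y \<bullet>\<^sub>c V k = 0" if "k \<in> P" for k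
    using xyP(4-7)[OF that] by (simp_all add: sp_commute)
  \<comment> \<open>The contribution of the position \<open>k = (z, i, j)\<close>: it sends \<open>U k\<close> to \<open>z U k\<close> plus the predecessor of
    \<open>U k\<close>, and is made skew-symmetric by the elementary skew maps.\<close>
  define T where "T k = (\<lambda>Z. fst k *s elementary_skew (U k) (V k) Z +
    (if snd (snd k) = 0 then 0 else elementary_skew (U (fst k, fst (snd k), snd (snd k) - 1)) (V k) Z))" for k
  have prev: "(z,i,j-1) \<in> P" if "(z,i,j) \<in> P" for z i j
    using that by (auto simp: P_def jordan_index_def)
  have T: "clinear (T k)" for k
    unfolding T_def by (cases "snd (snd k) = 0") (simp_all add: clinear_intros clinear_elementary_skew)
  have Tskew: "T k Z \<bullet>\<^sub>c W = - (Z \<bullet>\<^sub>c T k W)" for k Z W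
    by (cases "snd (snd k) = 0") (simp_all add: T_def elementary_skew_skew)
  define A where "A Z = (\<Sum>k\<in>P. T k Z)" for Z
  have A: "clinear A" unfolding A_def by (intro clinear_sum T)
  have T0: "T k Z = 0" if "k \<in> P" "\<And>l. l \<in> P \<Longrightarrow> U l \<bullet>\<^sub>c Z = 0" "\<And>l. l \<in> P \<Longrightarrow> V l \<bullet>\<^sub>c Z = 0" for k Z
    using that prev[of "fst k" "fst (snd k)" "snd (snd k)"] by (simp add: T_def elementary_skew_def)
  have "skew_extension A x y"
  proof (rule skew_extension.intro)
    show "A Z \<bullet>\<^sub>c W = - (Z \<bullet>\<^sub>c A W)" for Z W
      unfolding A_def by (simp add: sp_sum Tskew sum_negf)
    show "A x = 0" "A y = 0" unfolding A_def using xyP T0 by (auto intro!: sum.neutral)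
  qed (fact A xyP)+
  then interpret S: skew_extension A x y .
  have TU: "T (z,i,j) (U l) = (if (z,i,j) = l then z *s U l + (if j = 0 then 0 else U (z,i,j-1)) else 0)"
    if k: "(z,i,j) \<in> P" and l: "l \<in> P" for z i j l
    using UV[OF k l] UV[OF prev[OF k] l] by (auto simp: T_def elementary_skew_def)
  have AU: "A (U (z,i,j)) = z *s U (z,i,j) + (if j = 0 then 0 else U (z,i,j-1))"
    if l: "(z,i,j) \<in> P" for z i j
  proof -
    have "A (U (z,i,j)) = (\<Sum>k\<in>P. if k = (z,i,j) then z *s U (z,i,j) + (if j = 0 then 0 else U (z,i,j-1)) else 0)"
      unfolding A_def
    proof (rule sum.cong[OF refl])
      fix k assume "k \<in> P"
      moreover obtain z' i' j' where k: "k = (z',i',j')" by (metis prod_cases3)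
      ultimately show "T k (U (z,i,j)) = (if k = (z,i,j) then z *s U (z,i,j) + (if j = 0 then 0 else U (z,i,j-1)) else 0)"
        using TU[of z' i' j' "(z,i,j)"] l by auto
    qed
    then show ?thesis using l finP by simp
  qed
  have TV: "T (z,i,j) (V l) = (if (z,i,j) = l then (- z) *s V l else 0)
      + (if j \<noteq> 0 \<and> (z,i,j-1) = l then - V (z,i,j) else 0)"
    if k: "(z,i,j) \<in> P" and l: "l \<in> P" for z i j l
  proof (cases "j = 0")
    case True
    then show ?thesis using UV(2,3)[OF k l] by (auto simp: T_def elementary_skew_def)
  next
    case False
    define k' where "k' = (z,i,j-1)"
    have ne: "k' \<noteq> l" if "(z,i,j) = l" using that False by (auto simp: k'_def)
    have "T (z,i,j) (V l) = z *s elementary_skew (U (z,i,j)) (V (z,i,j)) (V l) + elementary_skew (U k') (V (z,i,j)) (V l)"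
      using False by (simp add: T_def k'_def)
    also have "\<dots> = (if (z,i,j) = l then (- z) *s V l else 0) + (if k' = l then - V (z,i,j) else 0)"
      using UV(2,3)[OF k l] UV(3)[OF prev[OF k] l, folded k'_def] ne by (auto simp: elementary_skew_def)
    finally show ?thesis using False by (simp add: k'_def)
  qed
  have AV: "A (V (z,i,j)) = (- z) *s V (z,i,j) - (if Suc j < d z ! i then V (z,i,Suc j) else 0)"
    if l: "(z,i,j) \<in> P" for z i j
  proof -
    have S: "(z,i,Suc j) \<in> P \<longleftrightarrow> Suc j < d z ! i" using l by (auto simp: P_def jordan_index_def)
    have "A (V (z,i,j)) = (\<Sum>k\<in>P. (if k = (z,i,j) then (- z) *s V (z,i,j) else 0) +
        (if k = (z,i,Suc j) then - V (z,i,Suc j) else 0))"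
      unfolding A_def
    proof (rule sum.cong[OF refl])
      fix k assume "k \<in> P"
      moreover obtain z' i' j' where k: "k = (z',i',j')" by (metis prod_cases3)
      moreover have "j' \<noteq> 0 \<and> (z',i',j'-1) = (z,i,j) \<longleftrightarrow> k = (z,i,Suc j)" using k by auto
      ultimately show "T k (V (z,i,j)) = (if k = (z,i,j) then (- z) *s V (z,i,j) else 0) +
          (if k = (z,i,Suc j) then - V (z,i,Suc j) else 0)"
        using TV[of z' i' j' "(z,i,j)"] l by auto
    qed
    also have "\<dots> = (- z) *s V (z,i,j) - (if Suc j < d z ! i then V (z,i,Suc j) else 0)"
      unfolding sum.distrib using l finP S by simp
    finally show ?thesis .
  qed
  define e where "e = (\<lambda>(w,i,j). if w \<in> half_plane then U (w,i,j) else (-1) ^ j *s V (-w, i, d w ! i - 1 - j))"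
  define g where "g = (\<lambda>(w,i,j). if w \<in> half_plane then V (w,i,j) else (-1) ^ j *s U (-w, i, d w ! i - 1 - j))"
  have memP: "(w,i,j) \<in> P" if "(w,i,j) \<in> ?I" "w \<in> half_plane" for w i j
    using that by (simp add: P_def)
  have memN: "(-w,i,d w ! i - 1 - j) \<in> P" if "(w,i,j) \<in> ?I" "w \<notin> half_plane" for w i j
    using that hp[of w] sym[of w] ds[of w] by (auto simp: P_def jordan_index_def)
  have dual: "e k \<bullet>\<^sub>c g l = (if k = l then 1 else 0)" if kl: "k \<in> ?I" "l \<in> ?I" for k l
  proof -
    obtain w i j w' i' j' where k: "k = (w,i,j)" "l = (w',i',j')" by (metis prod_cases3)
    note I = kl[unfolded k]
    consider "w \<in> half_plane" "w' \<in> half_plane" | "w \<in> half_plane" "w' \<notin> half_plane"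
      | "w \<notin> half_plane" "w' \<in> half_plane" | "w \<notin> half_plane" "w' \<notin> half_plane" by blast
    then show ?thesis
    proof cases
      case 1
      then show ?thesis using UV(3)[OF memP[OF I(1)] memP[OF I(2)]] by (simp add: k e_def g_def)
    next
      case 2
      then show ?thesis using UV(1)[OF memP[OF I(1)] memN[OF I(2)]] by (auto simp: k e_def g_def)
    next
      case 3
      then show ?thesis using UV(2)[OF memN[OF I(1)] memP[OF I(2)]] by (auto simp: k e_def g_def)
    next
      case 4
      have "j < d w ! i" "j' < d w' ! i'" using I by (auto simp: jordan_index_def)
      then have "(-w,i,d w ! i - 1 - j) = (-w',i',d w' ! i' - 1 - j') \<longleftrightarrow> k = l" by (auto simp: k)
      then have "e k \<bullet>\<^sub>c g l = (-1) ^ j * ((-1) ^ j' * (if k = l then 1 else 0))"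
        using UV(4)[OF memN[OF I(1)] memN[OF I(2)]] 4 by (simp add: k e_def g_def)
      also have "\<dots> = (if k = l then 1 else 0)" by (auto simp: k simp flip: power_mult_distrib)
      finally show ?thesis .
    qed
  qed
  note fam = dual_family_independent[OF finI dual]
  have sub: "e ` ?I \<subseteq> S.q"
  proof (clarify)
    fix w i j assume I: "(w,i,j) \<in> ?I"
    show "e (w,i,j) \<in> S.q"
      using xyP'[OF memP[OF I]] xyP'[OF memN[OF I]]
      by (cases "w \<in> half_plane") (simp_all add: e_def hyp_compl_def)
  qed
  have dimq: "vec.dim S.q = 2 * p" using S.dim_q card_n by simp
  have cIq: "card ?I = vec.dim S.q" unfolding cI dimq ..
  have "jordan_basis A S.q \<Lambda> d e"
    unfolding jordan_basis_def
  proof (intro conjI allI impI)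
    show "vec.span (e ` ?I) = S.q"
      by (rule independent_family_spans[OF finI S.subspace_q sub fam cIq])
    fix w i j assume I: "(w,i,j) \<in> ?I"
    show "A (e (w,i,j)) = w *s e (w,i,j) + (if j = 0 then 0 else e (w,i,j-1))"
    proof (cases "w \<in> half_plane")
      case True
      then show ?thesis using AU[OF memP[OF I True]] by (simp add: e_def)
    next
      case False
      have j: "j < d w ! i" and dw: "d (-w) = d w" using I ds[of w] by (auto simp: jordan_index_def)
      define k where "k = d w ! i - 1 - j"
      have ej: "e (w,i,j) = (-1) ^ j *s V (-w,i,k)" using False by (simp add: e_def k_def)
      have AVk: "A (V (-w,i,k)) = w *s V (-w,i,k) - (if Suc k < d w ! i then V (-w,i,Suc k) else 0)"
        using AV[OF memN[OF I False]] by (simp add: k_def dw)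
      show ?thesis
      proof (cases j)
        case 0
        then show ?thesis unfolding ej clinear_simps[OF A] AVk using j by (simp add: k_def)
      next
        case (Suc j')
        then have k: "Suc k < d w ! i" "Suc k = d w ! i - 1 - j'" using j by (auto simp: k_def)
        have "e (w,i,j-1) = (-1) ^ j' *s V (-w,i,Suc k)" using False by (simp add: e_def k(2) Suc)
        then show ?thesis unfolding ej clinear_simps[OF A] AVk using k(1) Suc
          by (simp add: vec_eq_iff algebra_simps)
      qed
    qed
  qed (use fam in auto)
  moreover have "m = restrict (\<lambda>z. \<Phi> (d z)) \<Lambda>"
    using m \<Phi> by (auto simp: PiE_iff extensional_def restrict_def fun_eq_iff)
  ultimately have jd: "jordan_data A S.q (\<Lambda>, m, d)" using d jordan_data_iff by blast
  have "S.q \<noteq> {0}"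
  proof
    assume "S.q = {0}"
    then have "vec.dim S.q = 0" by simp
    then show False using dimq p by simp
  qed
  then have "invertible_extension A x y" by (rule S.invertible_if_spectrum_nonzero[OF jd z0])
  then show ?thesis using jd tt by blast
qed

section \<open>The bijection\<close>

definition jordan_data_of :: "'n::finite bracket \<Rightarrow> jdata set" where
  "jordan_data_of br = {t. \<exists>X0 Y0 q. double_extension br X0 Y0 q \<and> jordan_data (br Y0) q t}"

lemma (in invertible_extension) jordan_data_ofI:
  assumes "jordan_data A q t"
  shows "t \<in> jordan_data_of br"
proof -
  have "br y = A" by (rule ext) (rule bracket_y)
  then have "jordan_data (br y) q t" using assms by simp
  then show ?thesis using double_extension unfolding jordan_data_of_def by blast
qed

lemma jordan_data_ofE:
  assumes "br \<in> S_inv" "t \<in> jordan_data_of br"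
  obtains A x y where "invertible_extension A x y" "br = ext_bracket A x" "jordan_data A (hyp_compl x y) t"
proof -
  obtain X0 Y0 q where D: "double_extension br X0 Y0 q" and t: "jordan_data (br Y0) q t"
    using assms(2) unfolding jordan_data_of_def by blast
  note S = S_inv_decomposition[OF assms(1) D]
  show ?thesis using that[OF S(1,2)] t unfolding S(3) .
qed

lemma jordan_data_of_nonempty:
  assumes "br \<in> S_inv"
  shows "jordan_data_of br \<noteq> {}"
proof -
  obtain X0 Y0 q where D: "double_extension br X0 Y0 q"
    using assms by (auto simp: S_inv_def invertible_singular_def)
  note S = S_inv_decomposition[OF assms D]
  interpret S: invertible_extension "br Y0" X0 Y0 by (rule S(1))
  obtain t where "jordan_data (br Y0) S.q t"
    using jordan_data_exists[OF S.lin S.subspace_q S.A_mem] by blast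
  then have "t \<in> jordan_data_of br" using D unfolding jordan_data_of_def S(3) by blast
  then show ?thesis by blast
qed

lemma jordan_data_of_subset_J:
  fixes br :: "'n::finite bracket"
  assumes n: "CARD('n) = 2 * p + 2" and br: "br \<in> S_inv"
  shows "jordan_data_of br \<subseteq> J p"
proof
  fix t assume "t \<in> jordan_data_of br"
  then obtain A x y where L: "invertible_extension A x y" "br = ext_bracket A x" "jordan_data A (hyp_compl x y) t"
    by (rule jordan_data_ofE[OF br])
  show "t \<in> J p" by (rule invertible_extension.jordan_data_in_J[OF L(1) n L(3)])
qed

lemma jordan_data_of_isomorphic:
  assumes br: "br \<in> S_inv" "br' \<in> S_inv" and iso: "isomorphic_brackets br br'"
    and t: "t \<in> jordan_data_of br" "t' \<in> jordan_data_of br'"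
  shows "\<exists>\<mu>. \<mu> \<noteq> 0 \<and> t' = scale_jdata \<mu> t"
proof -
  obtain A x y where L: "invertible_extension A x y" "br = ext_bracket A x" "jordan_data A (hyp_compl x y) t"
    by (rule jordan_data_ofE[OF br(1) t(1)])
  obtain A' x' y' where L': "invertible_extension A' x' y'" "br' = ext_bracket A' x'" "jordan_data A' (hyp_compl x' y') t'"
    by (rule jordan_data_ofE[OF br(2) t(2)])
  obtain \<mu> where \<mu>: "\<mu> \<noteq> 0" "jordan_data A' (hyp_compl x' y') (scale_jdata \<mu> t)"
    using isomorphism_scales_jordan_data[OF L(1) L'(1) _ L(3)] iso L(2) L'(2) by blast
  interpret L': invertible_extension A' x' y' by (rule L'(1))
  have "t' = scale_jdata \<mu> t" by (rule jordan_data_unique[OF L'.lin L'(3) \<mu>(2)])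
  then show ?thesis using \<mu>(1) by blast
qed

lemma jordan_data_of_scale:
  assumes br: "br \<in> S_inv" and t: "t \<in> jordan_data_of br" and \<mu>: "\<mu> \<noteq> 0"
  shows "scale_jdata \<mu> t \<in> jordan_data_of br"
proof -
  obtain A x y where L: "invertible_extension A x y" "br = ext_bracket A x" "jordan_data A (hyp_compl x y) t"
    by (rule jordan_data_ofE[OF br t])
  interpret L: invertible_extension A x y by (rule L(1))
  note sc = L.scaled[OF \<mu>]
  interpret M: skew_extension "\<lambda>Z. \<mu> *s A Z" "(1 / \<mu>) *s x" "\<mu> *s y" by (rule sc(1))
  have "jordan_data (\<lambda>Z. \<mu> *s A Z) L.q (scale_jdata \<mu> t)"
    by (rule jordan_data_transport[OF M.lin clinear_ident L.subspace_q _ _ \<mu> _ L(3)]) auto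
  moreover have "invertible_extension (\<lambda>Z. \<mu> *s A Z) ((1 / \<mu>) *s x) (\<mu> *s y)"
    by (rule invertible_extension_other_decomposition[OF L(1) sc(1)]) (simp only: sc(2))
  ultimately show ?thesis
    using invertible_extension.jordan_data_ofI[of "\<lambda>Z. \<mu> *s A Z" "(1 / \<mu>) *s x" "\<mu> *s y"]
    unfolding sc(2,3) L(2) by blast
qed

lemma jordan_data_of_common_imp_isomorphic:
  assumes br: "br \<in> S_inv" "br' \<in> S_inv" and t: "t \<in> jordan_data_of br" "t \<in> jordan_data_of br'"
  shows "isomorphic_brackets br br'"
  using jordan_data_ofE[OF br(1) t(1)] jordan_data_ofE[OF br(2) t(2)] same_jordan_data_isomorphic
  by metis

lemma jordan_data_of_surj:
  assumes "CARD('n::finite) = 2 * p + 2" "p \<ge> 1" "t \<in> J p"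
  shows "\<exists>br\<in>(S_inv :: 'n bracket set). t \<in> jordan_data_of br"
proof -
  obtain A x and y :: "complex^'n" where L: "invertible_extension A x y" "jordan_data A (hyp_compl x y) t"
    using jordan_data_realized[OF assms] by blast
  interpret L: invertible_extension A x y by (rule L(1))
  show ?thesis using L.in_S_inv L.jordan_data_ofI[OF L(2)] by blast
qed

lemma isomorphic_brackets_trans:
  assumes "isomorphic_brackets br br'" "isomorphic_brackets br' br''"
  shows "isomorphic_brackets br br''"
proof -
  obtain \<phi> where \<phi>: "clinear \<phi>" "bij \<phi>" "\<And>X Y. \<phi> (br X Y) = br' (\<phi> X) (\<phi> Y)"
    using assms(1) unfolding isomorphic_brackets_def by blast
  obtain \<psi> where \<psi>: "clinear \<psi>" "bij \<psi>" "\<And>X Y. \<psi> (br' X Y) = br'' (\<psi> X) (\<psi> Y)"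
    using assms(2) unfolding isomorphic_brackets_def by blast
  show ?thesis
    unfolding isomorphic_brackets_def
    by (rule exI[of _ "\<lambda>X. \<psi> (\<phi> X)"])
      (use \<phi> \<psi> clinear_comp[OF \<psi>(1) \<phi>(1)] bij_comp[OF \<phi>(2) \<psi>(2)] in \<open>simp add: comp_def\<close>)
qed

lemma isomorphic_brackets_sym:
  assumes "isomorphic_brackets br br'"
  shows "isomorphic_brackets br' br"
proof -
  obtain \<phi> where \<phi>: "clinear \<phi>" "bij \<phi>" "\<And>X Y. \<phi> (br X Y) = br' (\<phi> X) (\<phi> Y)"
    using assms(1) unfolding isomorphic_brackets_def by blast
  have i: "\<phi> (inv \<phi> X) = X" "inv \<phi> (\<phi> X) = X" for X
    using \<phi>(2) by (simp_all add: bij_is_surj surj_f_inv_f bij_is_inj inv_f_f)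
  have "inv \<phi> (br' X Y) = br (inv \<phi> X) (inv \<phi> Y)" for X Y
    using \<phi>(3)[of "inv \<phi> X" "inv \<phi> Y"] by (metis i)
  moreover have "clinear (inv \<phi>)" using vec.inj_linear_imp_inv_linear[OF \<phi>(1)] \<phi>(2) by (simp add: bij_is_inj)
  ultimately show ?thesis unfolding isomorphic_brackets_def using bij_imp_bij_inv[OF \<phi>(2)] by blast
qed

lemma isomorphic_brackets_refl: "isomorphic_brackets br br"
  unfolding isomorphic_brackets_def using clinear_ident bij_id[unfolded id_def] by blast

lemma equiv_S_inv_iso: "equiv S_inv S_inv_iso"
  unfolding equiv_def refl_on_def sym_def trans_def S_inv_iso_def
  using isomorphic_brackets_refl isomorphic_brackets_sym isomorphic_brackets_trans by auto

theorem proposition7p11: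
  fixes p :: nat
  assumes "p \<ge> 1"
    and "CARD('n::finite) = 2 * p + 2"
  shows "\<exists>f. bij_betw f ((S_inv :: 'n bracket set) // S_inv_iso) (J p // J_orbit_rel p) \<and>
    (\<forall>(br :: 'n bracket) X0 Y0 q t.
       br \<in> S_inv \<longrightarrow> double_extension br X0 Y0 q \<longrightarrow> jordan_data (br Y0) q t \<longrightarrow>
       t \<in> f (S_inv_iso `` {br}))"
proof -
  define f where "f c = (\<Union>br\<in>c. jordan_data_of br)" for c :: "'n bracket set"
  have orbit: "f (S_inv_iso `` {br}) = J_orbit_rel p `` {t}" if br: "br \<in> S_inv" and t: "t \<in> jordan_data_of br"
    for br :: "'n bracket" and t
  proof
    show "f (S_inv_iso `` {br}) \<subseteq> J_orbit_rel p `` {t}"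
    proof
      fix t' assume "t' \<in> f (S_inv_iso `` {br})"
      then obtain br' where "br' \<in> S_inv" "isomorphic_brackets br br'" "t' \<in> jordan_data_of br'"
        by (auto simp: f_def S_inv_iso_def)
      then obtain \<mu> where "\<mu> \<noteq> 0" "t' = scale_jdata \<mu> t" using jordan_data_of_isomorphic br t by blast
      then show "t' \<in> J_orbit_rel p `` {t}"
        using jordan_data_of_subset_J[OF assms(2) br] t unfolding J_orbit_rel_def by blast
    qed
    have "br \<in> S_inv_iso `` {br}" using br isomorphic_brackets_refl by (simp add: S_inv_iso_def)
    moreover have "J_orbit_rel p `` {t} \<subseteq> jordan_data_of br"
      using jordan_data_of_scale[OF br t] by (auto simp: J_orbit_rel_def)
    ultimately show "J_orbit_rel p `` {t} \<subseteq> f (S_inv_iso `` {br})" unfolding f_def by blast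
  qed
  have "bij_betw f ((S_inv :: 'n bracket set) // S_inv_iso) (J p // J_orbit_rel p)"
    unfolding bij_betw_def
  proof
    show "inj_on f ((S_inv :: 'n bracket set) // S_inv_iso)"
    proof (rule inj_onI)
      fix c c' assume c: "c \<in> (S_inv :: 'n bracket set) // S_inv_iso" "c' \<in> S_inv // S_inv_iso" "f c = f c'"
      obtain br where br: "br \<in> S_inv" "c = S_inv_iso `` {br}" using c(1) by (rule quotientE)
      obtain br' where br': "br' \<in> S_inv" "c' = S_inv_iso `` {br'}" using c(2) by (rule quotientE)
      obtain t where t: "t \<in> jordan_data_of br" using jordan_data_of_nonempty[OF br(1)] by blast
      have "br \<in> c" using br isomorphic_brackets_refl by (simp add: S_inv_iso_def)
      then have "t \<in> f c'" using t c(3) unfolding f_def by blast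
      then obtain br'' where br'': "br'' \<in> S_inv" "isomorphic_brackets br' br''" "t \<in> jordan_data_of br''"
        unfolding br'(2) by (auto simp: f_def S_inv_iso_def)
      have "isomorphic_brackets br br''"
        by (rule jordan_data_of_common_imp_isomorphic[OF br(1) br''(1) t br''(3)])
      then have "isomorphic_brackets br br'"
        using br''(2) isomorphic_brackets_sym isomorphic_brackets_trans by blast
      then have "(br, br') \<in> S_inv_iso" using br(1) br'(1) by (simp add: S_inv_iso_def)
      then show "c = c'" unfolding br(2) br'(2) by (rule equiv_class_eq[OF equiv_S_inv_iso])
    qed
    show "f ` ((S_inv :: 'n bracket set) // S_inv_iso) = J p // J_orbit_rel p"
    proof (intro equalityI subsetI)
      fix o' assume "o' \<in> f ` ((S_inv :: 'n bracket set) // S_inv_iso)"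
      then obtain c where c: "c \<in> (S_inv :: 'n bracket set) // S_inv_iso" "o' = f c" by blast
      obtain br where br: "br \<in> S_inv" "c = S_inv_iso `` {br}" using c(1) by (rule quotientE)
      obtain t where t: "t \<in> jordan_data_of br" using jordan_data_of_nonempty[OF br(1)] by blast
      have "t \<in> J p" using jordan_data_of_subset_J[OF assms(2) br(1)] t by blast
      then show "o' \<in> J p // J_orbit_rel p" unfolding c(2) br(2) orbit[OF br(1) t] by (rule quotientI)
    next
      fix o' assume "o' \<in> J p // J_orbit_rel p"
      then obtain t where t: "t \<in> J p" "o' = J_orbit_rel p `` {t}" by (rule quotientE)
      obtain br :: "'n bracket" where br: "br \<in> S_inv" "t \<in> jordan_data_of br"
        using jordan_data_of_surj[OF assms(2,1) t(1)] by blast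
      show "o' \<in> f ` ((S_inv :: 'n bracket set) // S_inv_iso)"
        unfolding t(2) orbit[OF br, symmetric] by (intro imageI quotientI br)
    qed
  qed
  moreover have "t \<in> f (S_inv_iso `` {br})"
    if "br \<in> S_inv" "double_extension br X0 Y0 q" "jordan_data (br Y0) q t" for br :: "'n bracket" and X0 Y0 q t
  proof -
    have "br \<in> S_inv_iso `` {br}" using that(1) isomorphic_brackets_refl by (simp add: S_inv_iso_def)
    moreover have "t \<in> jordan_data_of br" using that(2,3) unfolding jordan_data_of_def by blast
    ultimately show ?thesis unfolding f_def by blast
  qed
  ultimately show ?thesis by blast
qed

end
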